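(* Let $\mathcal{E}_{\mathcal N}=\mathcal{E}_d\circ\cdots\circ\mathcal{E}_1$ be a noisy quantum circuit on $n$ qubits with $N_1$ single-qubit noises and $N_2$ two-qubit noises (all other $\mathcal{E}_i$ being noiseless unitary gates), and let $N=N_1+N_2$. Suppose every noise $\mathcal{E}_s$ of the circuit has noise rate less than $p$, i.e. $\|M_{\mathcal{E}_s}-I\|<p$. Let $0\le l<N$ be an integer, and let $|\psi\rangle$, $|v\rangle$ be any $n$-qubit pure states (unit vectors). Put $$G=\langle v|\,\mathcal{E}_{\mathcal N}(|\psi\rangle\langle\psi|)\,|v\rangle,\qquad G'=\big(\langle v|\otimes\langle v^*|\big)\,A(l)\,\big(|\psi\rangle\otimes|\psi^*\rangle\big),$$ where $A(l)$ is the $l$-level approximation of the circuit. Then $$|G-G'|<\sum_{u=l+1}^{N}\binom{N}{u}(16p)^u(1+16p)^{N-u},$$ and the number of tensor network contractions used by the $l$-level approximation algorithm to compute $G'$ is $\mathcal{O}(15^l N^l)$.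
   Context: Conventions. $\|\cdot\|$ is the matrix 2-norm (operator/spectral norm). $*$ denotes the entrywise complex conjugate (of a vector or matrix in the computational basis). A quantum channel $\mathcal{E}=\{E_k\}_k$ is the map $\mathcal{E}(\rho)=\sum_k E_k\rho E_k^\dagger$ with $\sum_k E_k^\dagger E_k=I$. Its matrix representation is $M_{\mathcal{E}}=\sum_k E_k\otimes E_k^*$; for a unitary gate $\mathcal{U}=\{U\}$ this is $M_{\mathcal{U}}=U\otimes U^*$. Each $\mathcal{E}_i$ in a noisy circuit is either a noiseless unitary gate (on one or two qubits) or a noise, i.e. a quantum channel acting on one qubit (single-qubit noise) or two qubits (two-qubit noise), extended by the identity to the other qubits. Noise rate. For a noise $\mathcal{E}_s$ acting on a local space of dimension $q$ ($q=2$ for single-qubit, $q=4$ for two-qubit), $M_{\mathcal{E}_s}$ is regarded as a $q^2\times q^2$ matrix (so $4\times4$ or $16\times 16$), and its noise rate is $\|M_{\mathcal{E}_s}-I\|$ with $I$ the identity of the same size. Tensor permutation. For a $q^2\times q^2$ matrix $A$ with rows indexed by pairs $(a,b)$ and columns by pairs $(c,e)$, $a,b,c,e\in\{0,\dots,q-1\}$, $\tilde A$ is the $q^2\times q^2$ matrix with $\tilde A_{(a,c),(b,e)}=A_{(a,b),(c,e)}$. SVD decomposition of a noise. For a noise $\mathcal{E}_s$ let $m=q^2$ ($m=4$ for single-qubit, $m=16$ for two-qubit) and take a singular value decomposition $\widetilde{M_{\mathcal{E}_s}}=SDT^\dagger$, $D=\sum_{j=0}^{m-1}d_j|j\rangle\langle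 j|$, with $d_0$ the largest singular value. Let $U^s_j,V^s_j$ be the $q\times q$ matrices with $(U^s_j)_{a,c}=d_j S_{(a,c),j}$ and $(V^s_j)_{b,e}=\overline{T_{(b,e),j}}$. Then $M_{\mathcal{E}_s}=\sum_{j=0}^{m-1}U^s_j\otimes V^s_j$. Put $M'_{\mathcal{E}_s}=U^s_0\otimes V^s_0$ (dominant term) and $\overline{M_{\mathcal{E}_s}}=\sum_{j=1}^{m-1}U^s_j\otimes V^s_j$ (residual). $l$-level approximation. The full circuit has matrix representation $M_{\mathcal{E}_{\mathcal N}}=M_{\mathcal{E}_d}\cdots M_{\mathcal{E}_1}$, acting on two copies of the $n$-qubit space (each local matrix extended by the identity; the first tensor factor acts on the first copy and the second on the second copy). For $0\le u\le N$, $T_u$ is the sum, over all $u$-element subsets $P$ of the set of the $N$ noises, of the product $M_{\mathcal{E}_d}\cdots M_{\mathcal{E}_1}$ in which the factor $M_{\mathcal{E}_s}$ is replaced by $\overline{M_{\mathcal{E}_s}}$ for each noise $s\in P$ and by $M'_{\mathcal{E}_s}$ for each noise $s\notin P$, the noiseless gate factors being unchanged. The $l$-level approximation is $A(l)=\sum_{u=0}^{l}T_u$. Algorithm and contraction count. The algorithm computes $G'$ as follows: for every $0\le u\le l$, every $u$-element set $P$ of noises, and every choice of one residual term $U^s_{j_s}\otimes V^s_{j_s}$ with $1\le j_s\le m_s-1$ for each $s\in P$ (where $m_s$ is $4$ or $16$ according to whether $s$ is single- or two-qubit), with all noises outside $P$ replaced by $U^s_0\otimes V^s_0$, the doubled network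 splits into two $n$-qubit networks; both are contracted (two contractions), the resulting scalars are multiplied, and all these products are added up. The number of contractions is the total number of $n$-qubit networks contracted. *)

theory Defs
  imports "Jordan_Normal_Form.Schur_Decomposition" "HOL-Library.FuncSet"
begin

section \<open>Matrices\<close>

definition l2_norm :: "complex vec \<Rightarrow> real" where
  "l2_norm x = sqrt (\<Sum>i<dim_vec x. (cmod (x $ i))\<^sup>2)"

definition spectral_norm :: "complex mat \<Rightarrow> real" where
  "spectral_norm A =
     (SUP x \<in> {x \<in> carrier_vec (dim_col A). l2_norm x \<le> 1}. l2_norm (A *\<^sub>v x))"

definition conj_mat :: "complex mat \<Rightarrow> complex mat" where
  "conj_mat A = map_mat cnj A"

definition unitary_mat :: "nat \<Rightarrow> complex mat \<Rightarrow> bool" where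
  "unitary_mat q U \<longleftrightarrow>
     U \<in> carrier_mat q q \<and> mat_adjoint U * U = 1\<^sub>m q \<and> U * mat_adjoint U = 1\<^sub>m q"

definition mat_sum :: "nat \<Rightarrow> ('i \<Rightarrow> complex mat) \<Rightarrow> 'i set \<Rightarrow> complex mat" where
  "mat_sum q F I = mat q q (\<lambda>ij. \<Sum>x\<in>I. F x $$ ij)"

text \<open>The head of the list is the factor that acts first, i.e. the rightmost one.\<close>

definition ordered_prod :: "nat \<Rightarrow> complex mat list \<Rightarrow> complex mat" where
  "ordered_prod q As = foldl (\<lambda>M A. A * M) (1\<^sub>m q) As"

text \<open>In a tensor product the pair of indices \<open>(a, b)\<close> is encoded as \<open>a * q + b\<close>, where
  \<open>q\<close> is the dimension of the second factor.\<close>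

definition kron :: "complex mat \<Rightarrow> complex mat \<Rightarrow> complex mat" where
  "kron A B = mat (dim_row A * dim_row B) (dim_col A * dim_col B)
     (\<lambda>(i, j). A $$ (i div dim_row B, j div dim_col B) * B $$ (i mod dim_row B, j mod dim_col B))"

definition kron_vec :: "complex vec \<Rightarrow> complex vec \<Rightarrow> complex vec" where
  "kron_vec x y = vec (dim_vec x * dim_vec y) (\<lambda>i. x $ (i div dim_vec y) * y $ (i mod dim_vec y))"

definition ket_bra :: "complex vec \<Rightarrow> complex mat" where
  "ket_bra x = mat (dim_vec x) (dim_vec x) (\<lambda>(i, j). x $ i * cnj (x $ j))"

text \<open>Row \<open>(a, c)\<close> and column \<open>(b, e)\<close> of the result hold the entry in row \<open>(a, b)\<close> and
  column \<open>(c, e)\<close> of \<open>A\<close>.\<close>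

definition tensor_perm :: "nat \<Rightarrow> complex mat \<Rightarrow> complex mat" where
  "tensor_perm q A = mat (q * q) (q * q)
     (\<lambda>(i, j). A $$ ((i div q) * q + j div q, (i mod q) * q + j mod q))"

section \<open>Operators on a register of qubits\<close>

text \<open>A register of \<open>m\<close> qubits has the computational basis \<open>{..<2 ^ m}\<close>; qubit \<open>k\<close> of the
  basis state \<open>x\<close> is \<open>bit x k\<close>. An operator acting on the list \<open>ks\<close> of distinct qubits is a
  matrix of dimension \<open>2 ^ length ks\<close>, in which \<open>ks ! i\<close> is bit \<open>i\<close> of the index.\<close>

definition local_index :: "nat list \<Rightarrow> nat \<Rightarrow> nat" where
  "local_index ks x = (\<Sum>i<length ks. of_bool (bit x (ks ! i)) * 2 ^ i)"

definition extend :: "nat \<Rightarrow> nat list \<Rightarrow> complex mat \<Rightarrow> complex mat" where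
  "extend m ks A = mat (2 ^ m) (2 ^ m)
     (\<lambda>(x, y). if \<forall>k<m. k \<notin> set ks \<longrightarrow> bit x k = bit y k
               then A $$ (local_index ks x, local_index ks y) else 0)"

text \<open>Two copies of an \<open>n\<close>-qubit register form a \<open>2 * n\<close>-qubit register. By the encoding of
  \<open>kron_vec\<close>, qubit \<open>k\<close> of the second copy is qubit \<open>k\<close> there, and qubit \<open>k\<close> of the
  first copy is qubit \<open>n + k\<close>; the first tensor factor of a local operator has to act on the
  high bits.\<close>

definition doubled :: "nat \<Rightarrow> nat list \<Rightarrow> nat list" where
  "doubled n ks = ks @ map (\<lambda>k. n + k) ks"

section \<open>Noisy circuits\<close>

text \<open>A gate is given by its unitary and a noise by its Kraus operators, both on the local space
  of the qubits acted on. The head of a circuit is applied first.\<close>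

datatype element =
    is_Gate: Gate (qubits: "nat list") "complex mat"
  | is_Noise: Noise (qubits: "nat list") "complex mat list"

fun kraus :: "element \<Rightarrow> complex mat list" where
  "kraus (Gate ks U) = [U]"
| "kraus (Noise ks Es) = Es"

definition ldim :: "element \<Rightarrow> nat" where
  "ldim e = 2 ^ length (qubits e)"

definition is_channel :: "nat \<Rightarrow> complex mat list \<Rightarrow> bool" where
  "is_channel q Es \<longleftrightarrow>
     set Es \<subseteq> carrier_mat q q \<and>
     mat_sum q (\<lambda>k. mat_adjoint (Es ! k) * Es ! k) {..<length Es} = 1\<^sub>m q"

fun valid_element :: "nat \<Rightarrow> element \<Rightarrow> bool" where
  "valid_element n (Gate ks U) \<longleftrightarrow>
     length ks \<in> {1, 2} \<and> distinct ks \<and> set ks \<subseteq> {..<n} \<and> unitary_mat (2 ^ length ks) U"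
| "valid_element n (Noise ks Es) \<longleftrightarrow>
     length ks \<in> {1, 2} \<and> distinct ks \<and> set ks \<subseteq> {..<n} \<and> is_channel (2 ^ length ks) Es"

definition noisy_circuit :: "nat \<Rightarrow> element list \<Rightarrow> bool" where
  "noisy_circuit n circ \<longleftrightarrow> (\<forall>e\<in>set circ. valid_element n e)"

definition noises :: "element list \<Rightarrow> nat set" where
  "noises circ = {s. s < length circ \<and> is_Noise (circ ! s)}"

definition num_noises :: "element list \<Rightarrow> nat \<Rightarrow> nat" where
  "num_noises circ k = card {s \<in> noises circ. length (qubits (circ ! s)) = k}"

definition apply_element :: "nat \<Rightarrow> element \<Rightarrow> complex mat \<Rightarrow> complex mat" where
  "apply_element n e \<rho> =
     mat_sum (2 ^ n)
       (\<lambda>k. extend n (qubits e) (kraus e ! k) * \<rho> * mat_adjoint (extend n (qubits e) (kraus e ! k)))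
       {..<length (kraus e)}"

definition apply_circuit :: "nat \<Rightarrow> element list \<Rightarrow> complex mat \<Rightarrow> complex mat" where
  "apply_circuit n circ \<rho> = fold (apply_element n) circ \<rho>"

definition exact_value :: "nat \<Rightarrow> element list \<Rightarrow> complex vec \<Rightarrow> complex vec \<Rightarrow> complex" where
  "exact_value n circ \<psi> v = (apply_circuit n circ (ket_bra \<psi>) *\<^sub>v v) \<bullet>c v"

section \<open>Matrix representation, noise rate and singular value decomposition\<close>

definition mat_rep :: "element \<Rightarrow> complex mat" where
  "mat_rep e = mat_sum (ldim e * ldim e)
     (\<lambda>k. kron (kraus e ! k) (conj_mat (kraus e ! k))) {..<length (kraus e)}"

definition noise_rate :: "element \<Rightarrow> real" where
  "noise_rate e = spectral_norm (mat_rep e - 1\<^sub>m (ldim e * ldim e))"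

type_synonym svd = "complex mat \<times> (nat \<Rightarrow> real) \<times> complex mat"

text \<open>Of the order of the singular values only the choice of \<open>d 0\<close> is fixed.\<close>

fun is_svd :: "nat \<Rightarrow> complex mat \<Rightarrow> svd \<Rightarrow> bool" where
  "is_svd m A (S, d, T) \<longleftrightarrow>
     unitary_mat m S \<and> unitary_mat m T \<and> (\<forall>j<m. 0 \<le> d j \<and> d j \<le> d 0) \<and>
     A = S * mat_diag m (\<lambda>j. complex_of_real (d j)) * mat_adjoint T"

fun svd_U :: "nat \<Rightarrow> svd \<Rightarrow> nat \<Rightarrow> complex mat" where
  "svd_U q (S, d, T) j = mat q q (\<lambda>(a, c). complex_of_real (d j) * S $$ (a * q + c, j))"

fun svd_V :: "nat \<Rightarrow> svd \<Rightarrow> nat \<Rightarrow> complex mat" where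
  "svd_V q (S, d, T) j = mat q q (\<lambda>(b, e). cnj (T $$ (b * q + e, j)))"

definition dominant :: "nat \<Rightarrow> svd \<Rightarrow> complex mat" where
  "dominant q w = kron (svd_U q w 0) (svd_V q w 0)"

definition residual :: "nat \<Rightarrow> svd \<Rightarrow> complex mat" where
  "residual q w = mat_sum (q * q) (\<lambda>j. kron (svd_U q w j) (svd_V q w j)) {1..<q * q}"

text \<open>A choice of decompositions assigns one to the position of every noise.\<close>

definition svd_choice :: "element list \<Rightarrow> (nat \<Rightarrow> svd) \<Rightarrow> bool" where
  "svd_choice circ w \<longleftrightarrow>
     (\<forall>s\<in>noises circ. let q = ldim (circ ! s) in
        is_svd (q * q) (tensor_perm q (mat_rep (circ ! s))) (w s))"

section \<open>The approximation\<close>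

definition factor :: "nat \<Rightarrow> element list \<Rightarrow> (nat \<Rightarrow> svd) \<Rightarrow> nat set \<Rightarrow> nat \<Rightarrow> complex mat" where
  "factor n circ w P s =
     extend (2 * n) (doubled n (qubits (circ ! s)))
       (if is_Noise (circ ! s)
        then if s \<in> P then residual (ldim (circ ! s)) (w s) else dominant (ldim (circ ! s)) (w s)
        else mat_rep (circ ! s))"

definition T_term :: "nat \<Rightarrow> element list \<Rightarrow> (nat \<Rightarrow> svd) \<Rightarrow> nat \<Rightarrow> complex mat" where
  "T_term n circ w u =
     mat_sum (2 ^ (2 * n))
       (\<lambda>P. ordered_prod (2 ^ (2 * n)) (map (factor n circ w P) [0..<length circ]))
       {P. P \<subseteq> noises circ \<and> card P = u}"

definition level_approx :: "nat \<Rightarrow> element list \<Rightarrow> (nat \<Rightarrow> svd) \<Rightarrow> nat \<Rightarrow> complex mat" where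
  "level_approx n circ w l = mat_sum (2 ^ (2 * n)) (T_term n circ w) {0..l}"

definition approx_value ::
  "nat \<Rightarrow> element list \<Rightarrow> (nat \<Rightarrow> svd) \<Rightarrow> nat \<Rightarrow> complex vec \<Rightarrow> complex vec \<Rightarrow> complex" where
  "approx_value n circ w l \<psi> v =
     (level_approx n circ w l *\<^sub>v kron_vec \<psi> (conjugate \<psi>)) \<bullet>c kron_vec v (conjugate v)"

section \<open>The algorithm\<close>

text \<open>A network consists of an input state, local operators with the qubits they act on, and an
  output state.\<close>

type_synonym network = "complex vec \<times> (nat list \<times> complex mat) list \<times> complex vec"

fun contract :: "nat \<Rightarrow> network \<Rightarrow> complex" where
  "contract n (\<psi>, ts, v) =
     (ordered_prod (2 ^ n) (map (\<lambda>(ks, A). extend n ks A) ts) *\<^sub>v \<psi>) \<bullet>c v"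

definition runs :: "element list \<Rightarrow> nat \<Rightarrow> (nat set \<times> (nat \<Rightarrow> nat)) set" where
  "runs circ l =
     (SIGMA P : {P. P \<subseteq> noises circ \<and> card P \<le> l}.
        \<Pi>\<^sub>E s\<in>P. {1..(ldim (circ ! s))\<^sup>2 - 1})"

definition first_tensor ::
  "element list \<Rightarrow> (nat \<Rightarrow> svd) \<Rightarrow> nat set \<Rightarrow> (nat \<Rightarrow> nat) \<Rightarrow> nat \<Rightarrow> nat list \<times> complex mat" where
  "first_tensor circ w P j s =
     (case circ ! s of
        Gate ks U \<Rightarrow> (ks, U)
      | Noise ks Es \<Rightarrow> (ks, svd_U (2 ^ length ks) (w s) (if s \<in> P then j s else 0)))"

definition second_tensor ::
  "element list \<Rightarrow> (nat \<Rightarrow> svd) \<Rightarrow> nat set \<Rightarrow> (nat \<Rightarrow> nat) \<Rightarrow> nat \<Rightarrow> nat list \<times> complex mat" where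
  "second_tensor circ w P j s =
     (case circ ! s of
        Gate ks U \<Rightarrow> (ks, conj_mat U)
      | Noise ks Es \<Rightarrow> (ks, svd_V (2 ^ length ks) (w s) (if s \<in> P then j s else 0)))"

text \<open>The networks contracted in one run; the resulting scalars are multiplied.\<close>

fun networks ::
  "element list \<Rightarrow> (nat \<Rightarrow> svd) \<Rightarrow> complex vec \<Rightarrow> complex vec \<Rightarrow> nat set \<times> (nat \<Rightarrow> nat) \<Rightarrow> network list"
where
  "networks circ w \<psi> v (P, j) =
     [(\<psi>, map (first_tensor circ w P j) [0..<length circ], v),
      (conjugate \<psi>, map (second_tensor circ w P j) [0..<length circ], conjugate v)]"

definition algorithm_output ::
  "nat \<Rightarrow> element list \<Rightarrow> (nat \<Rightarrow> svd) \<Rightarrow> nat \<Rightarrow> complex vec \<Rightarrow> complex vec \<Rightarrow> complex" where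
  "algorithm_output n circ w l \<psi> v =
     (\<Sum>r\<in>runs circ l. prod_list (map (contract n) (networks circ w \<psi> v r)))"

definition num_contractions ::
  "element list \<Rightarrow> (nat \<Rightarrow> svd) \<Rightarrow> nat \<Rightarrow> complex vec \<Rightarrow> complex vec \<Rightarrow> nat" where
  "num_contractions circ w l \<psi> v = (\<Sum>r\<in>runs circ l. length (networks circ w \<psi> v r))"

end

theory Submission
  imports Defs "HOL-Analysis.L2_Norm"
begin

text \<open>The tensor permutation turns the identity into the rank one matrix \<open>w w\<^sup>T\<close> of the
  vectorised identity \<open>w\<close> and preserves the Frobenius norm. Truncating a singular value
  decomposition to its first term is at least as good as the approximation by \<open>w w\<^sup>T\<close>, so for a
  noise on a space of dimension \<open>q \<le> 4\<close> the residual has Frobenius norm at most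
  \<open>\<parallel>M - 1\<parallel>\<^sub>F \<le> q \<parallel>M - 1\<parallel> < 4 p\<close>, and the dominant term, which is
  \<open>1 + (M - 1)\<close> minus the residual, has operator norm at most \<open>1 + 8 p\<close>. Operator norms do
  not grow when a local operator is extended to the register. The error is the sum of the products
  with more than \<open>l\<close> residual factors, hence at most
  \<open>\<Sum>u>l. (N choose u) (4 p)\<^sup>u (1 + 8 p)\<^sup>N\<^sup>-\<^sup>u\<close>.\<close>

section \<open>Matrices in coordinates\<close>

text \<open>The tensor permutation does not respect operator norms: it sends the identity, of norm
  1, to a matrix of norm q. Hence the comparison runs in the Frobenius norm, which sees only the
  entries, and the passage back costs the factor q, because M - 1 has q^2 columns, each of length at
  most its operator norm. The matrix of a channel may have operator norm above 1, and singular
  vectors need not be unique, so the estimate uses only the singular values: any decomposition with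
  \<open>d 0\<close> largest will do. Crude bounds suffice, since 4 and 8 stay below 16; this gap
  also yields the strict inequality. Outside the estimate for a single noise, the exact value is put
  into the form of the approximation by vectorising density matrices; both are then sums of the same
  products over sets of noises.\<close>

lemma mult_add_less:
  fixes i j a b :: nat
  assumes "i < a" "j < b"
  shows "i * b + j < a * b"
proof -
  have "i * b + j < Suc i * b" using assms by simp
  also have "\<dots> \<le> a * b" using assms by (intro mult_right_mono) auto
  finally show ?thesis .
qed

lemma div_mod_less:
  fixes i a c :: nat
  assumes "i < a * c"
  shows "i div c < a" "i mod c < c"
  using assms by (auto simp: less_mult_imp_div_less intro!: mod_less_divisor gr0I)

text \<open>The encoding of a pair as \<open>i * b + j\<close> is a bijection. This is what
  separates the two tensor factors in the sums over \<open>kron\<close> and \<open>vectorize\<close>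
  indices.\<close>

lemma sum_div_mod:
  fixes f :: "nat \<Rightarrow> nat \<Rightarrow> 'a::comm_monoid_add"
  shows "(\<Sum>k<a * b. f (k div b) (k mod b)) = (\<Sum>i<a. \<Sum>j<b. f i j)"
proof (cases "b = 0")
  case False
  have "(\<Sum>i<a. \<Sum>j<b. f i j) = (\<Sum>(i, j)\<in>{..<a} \<times> {..<b}. f i j)"
    by (rule sum.cartesian_product)
  also have "\<dots> = (\<Sum>k<a * b. f (k div b) (k mod b))"
    by (rule sum.reindex_bij_witness[where i = "\<lambda>k. (k div b, k mod b)" and j = "\<lambda>(i, j). i * b + j"])
      (auto simp: div_mod_less mult_add_less)
  finally show ?thesis by simp
qed simp

lemma sum_product_div_mod:
  fixes f g :: "nat \<Rightarrow> 'a::comm_semiring_0"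
  shows "(\<Sum>i<a. f i) * (\<Sum>j<b. g j) = (\<Sum>k<a * b. f (k div b) * g (k mod b))"
  using sum_div_mod[of "\<lambda>i j. f i * g j" b a] by (simp add: sum_product)

lemma mult_mat_index:
  assumes "A \<in> carrier_mat a b" "B \<in> carrier_mat b c" "i < a" "j < c"
  shows "(A * B) $$ (i, j) = (\<Sum>k<b. A $$ (i, k) * B $$ (k, j))"
  using assms by (auto simp: scalar_prod_def lessThan_atLeast0)

lemma mult_mat_vec_index:
  assumes "A \<in> carrier_mat a b" "x \<in> carrier_vec b" "i < a"
  shows "(A *\<^sub>v x) $ i = (\<Sum>k<b. A $$ (i, k) * x $ k)"
  using assms by (auto simp: scalar_prod_def lessThan_atLeast0)

lemma cscalar_prod_eq_sum:
  fixes x y :: "complex vec"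
  assumes "y \<in> carrier_vec m"
  shows "x \<bullet>c y = (\<Sum>i<m. x $ i * cnj (y $ i))"
  using assms by (auto simp: scalar_prod_def lessThan_atLeast0)

lemma mat_adjoint_carrier:
  fixes A :: "complex mat"
  assumes "A \<in> carrier_mat a b"
  shows "mat_adjoint A \<in> carrier_mat b a"
  using assms by (auto simp: mat_adjoint_def)

lemma mat_adjoint_index:
  fixes A :: "complex mat"
  assumes "A \<in> carrier_mat a b" "i < b" "j < a"
  shows "mat_adjoint A $$ (i, j) = cnj (A $$ (j, i))"
  using assms by (auto simp: mat_adjoint_def mat_of_rows_def)

lemma mat_sum_carrier [simp]: "mat_sum q F I \<in> carrier_mat q q"
  by (simp add: mat_sum_def)

lemma mat_sum_index:
  assumes "i < q" "j < q"
  shows "mat_sum q F I $$ (i, j) = (\<Sum>x\<in>I. F x $$ (i, j))"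
  using assms by (simp add: mat_sum_def)

lemma mat_sum_cong:
  assumes "\<And>x. x \<in> I \<Longrightarrow> F x = G x"
  shows "mat_sum q F I = mat_sum q G I"
  using assms by (simp add: mat_sum_def)

lemma mat_sum_singleton:
  assumes "F x \<in> carrier_mat q q"
  shows "mat_sum q F {x} = F x"
  using assms by (intro eq_matI) (auto simp: mat_sum_def)

lemma mat_sum_mult_mat_sum:
  assumes "finite I" "finite J"
    and "\<And>x. x \<in> I \<Longrightarrow> F x \<in> carrier_mat q q" "\<And>y. y \<in> J \<Longrightarrow> G y \<in> carrier_mat q q"
  shows "mat_sum q F I * mat_sum q G J = mat_sum q (\<lambda>(x, y). F x * G y) (I \<times> J)"
proof (rule eq_matI)
  fix i j assume "i < dim_row (mat_sum q (\<lambda>(x, y). F x * G y) (I \<times> J))"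
    "j < dim_col (mat_sum q (\<lambda>(x, y). F x * G y) (I \<times> J))"
  then have ij: "i < q" "j < q" by (auto simp: mat_sum_def)
  have "(mat_sum q F I * mat_sum q G J) $$ (i, j)
      = (\<Sum>k<q. (\<Sum>x\<in>I. F x $$ (i, k)) * (\<Sum>y\<in>J. G y $$ (k, j)))"
    using ij by (subst mult_mat_index[where b = q and a = q and c = q]) (auto simp: mat_sum_index)
  also have "\<dots> = (\<Sum>k<q. \<Sum>x\<in>I. \<Sum>y\<in>J. F x $$ (i, k) * G y $$ (k, j))"
    by (simp add: sum_product)
  also have "\<dots> = (\<Sum>x\<in>I. \<Sum>k<q. \<Sum>y\<in>J. F x $$ (i, k) * G y $$ (k, j))"
    by (rule sum.swap)
  also have "\<dots> = (\<Sum>x\<in>I. \<Sum>y\<in>J. \<Sum>k<q. F x $$ (i, k) * G y $$ (k, j))"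
    by (intro sum.cong refl sum.swap)
  also have "\<dots> = (\<Sum>x\<in>I. \<Sum>y\<in>J. (F x * G y) $$ (i, j))"
    using assms ij by (intro sum.cong refl) (subst mult_mat_index[where b = q and a = q and c = q]; auto)
  also have "\<dots> = mat_sum q (\<lambda>(x, y). F x * G y) (I \<times> J) $$ (i, j)"
    using ij by (simp add: mat_sum_index sum.cartesian_product case_prod_unfold)
  finally show "(mat_sum q F I * mat_sum q G J) $$ (i, j)
      = mat_sum q (\<lambda>(x, y). F x * G y) (I \<times> J) $$ (i, j)" .
qed (auto simp: mat_sum_def)

lemma mat_sum_reindex:
  assumes "bij_betw h J I"
  shows "mat_sum q F I = mat_sum q (\<lambda>x. F (h x)) J"
  unfolding mat_sum_def sum.reindex_bij_betw[OF assms, symmetric] ..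

lemma kron_carrier:
  assumes "A \<in> carrier_mat a b" "B \<in> carrier_mat c d"
  shows "kron A B \<in> carrier_mat (a * c) (b * d)"
  using assms by (auto simp: kron_def)

lemma kron_index:
  assumes "A \<in> carrier_mat a b" "B \<in> carrier_mat c d" "i < a * c" "j < b * d"
  shows "kron A B $$ (i, j) = A $$ (i div c, j div d) * B $$ (i mod c, j mod d)"
  using assms by (auto simp: kron_def)

lemma kron_mult:
  assumes "A \<in> carrier_mat a b" "B \<in> carrier_mat c d" "A' \<in> carrier_mat b e" "B' \<in> carrier_mat d f"
  shows "kron A B * kron A' B' = kron (A * A') (B * B')"
proof (rule eq_matI)
  have c: "kron A B \<in> carrier_mat (a * c) (b * d)" "kron A' B' \<in> carrier_mat (b * d) (e * f)"
    "A * A' \<in> carrier_mat a e" "B * B' \<in> carrier_mat c f"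
    using assms by (auto simp: kron_carrier)
  then have c': "kron (A * A') (B * B') \<in> carrier_mat (a * c) (e * f)" by (auto simp: kron_carrier)
  show "dim_row (kron A B * kron A' B') = dim_row (kron (A * A') (B * B'))"
    "dim_col (kron A B * kron A' B') = dim_col (kron (A * A') (B * B'))"
    using c c' by auto
  fix i j assume "i < dim_row (kron (A * A') (B * B'))" "j < dim_col (kron (A * A') (B * B'))"
  then have ij: "i < a * c" "j < e * f" using c' by auto
  have "(kron A B * kron A' B') $$ (i, j)
     = (\<Sum>k<b * d. (A $$ (i div c, k div d) * A' $$ (k div d, j div f))
          * (B $$ (i mod c, k mod d) * B' $$ (k mod d, j mod f)))"
    unfolding mult_mat_index[OF c(1,2) ij]
    using ij assms by (intro sum.cong refl) (simp add: kron_index[OF assms(1,2)] kron_index[OF assms(3,4)])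
  also have "\<dots> = (A * A') $$ (i div c, j div f) * (B * B') $$ (i mod c, j mod f)"
    using ij by (simp only: mult_mat_index[OF assms(1,3)] mult_mat_index[OF assms(2,4)] div_mod_less sum_product_div_mod)
  also have "\<dots> = kron (A * A') (B * B') $$ (i, j)"
    using ij c by (simp add: kron_index)
  finally show "(kron A B * kron A' B') $$ (i, j) = kron (A * A') (B * B') $$ (i, j)" .
qed

lemma kron_one: "kron (1\<^sub>m a) (1\<^sub>m b) = 1\<^sub>m (a * b)"
proof (rule eq_matI)
  fix i j assume "i < dim_row (1\<^sub>m (a * b) :: complex mat)" "j < dim_col (1\<^sub>m (a * b) :: complex mat)"
  then have ij: "i < a * b" "j < a * b" by auto
  have "i = j \<longleftrightarrow> i div b = j div b \<and> i mod b = j mod b"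
    using div_mult_mod_eq[of i b] div_mult_mod_eq[of j b] by metis
  then show "kron (1\<^sub>m a) (1\<^sub>m b) $$ (i, j) = 1\<^sub>m (a * b) $$ (i, j)"
    using ij by (simp add: kron_index[of _ a a _ b b] div_mod_less)
qed (auto simp: kron_def)

lemma kron_vec_carrier:
  assumes "x \<in> carrier_vec a" "y \<in> carrier_vec b"
  shows "kron_vec x y \<in> carrier_vec (a * b)"
  using assms by (auto simp: kron_vec_def)

lemma kron_vec_index:
  assumes "x \<in> carrier_vec a" "y \<in> carrier_vec b" "i < a * b"
  shows "kron_vec x y $ i = x $ (i div b) * y $ (i mod b)"
  using assms by (auto simp: kron_vec_def)

lemma kron_mult_kron_vec:
  assumes "A \<in> carrier_mat a b" "B \<in> carrier_mat c d" "x \<in> carrier_vec b" "y \<in> carrier_vec d"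
  shows "kron A B *\<^sub>v kron_vec x y = kron_vec (A *\<^sub>v x) (B *\<^sub>v y)"
proof (rule eq_vecI)
  have c: "kron A B \<in> carrier_mat (a * c) (b * d)" "kron_vec x y \<in> carrier_vec (b * d)"
    "A *\<^sub>v x \<in> carrier_vec a" "B *\<^sub>v y \<in> carrier_vec c"
    using assms by (auto simp: kron_carrier kron_vec_carrier)
  then have c': "kron_vec (A *\<^sub>v x) (B *\<^sub>v y) \<in> carrier_vec (a * c)" by (auto simp: kron_vec_carrier)
  show "dim_vec (kron A B *\<^sub>v kron_vec x y) = dim_vec (kron_vec (A *\<^sub>v x) (B *\<^sub>v y))"
    using c c' by auto
  fix i assume "i < dim_vec (kron_vec (A *\<^sub>v x) (B *\<^sub>v y))"
  then have i: "i < a * c" using c' by auto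
  have "(kron A B *\<^sub>v kron_vec x y) $ i
     = (\<Sum>k<b * d. (A $$ (i div c, k div d) * x $ (k div d)) * (B $$ (i mod c, k mod d) * y $ (k mod d)))"
    unfolding mult_mat_vec_index[OF c(1,2) i]
    using i assms by (intro sum.cong refl) (simp add: kron_index[OF assms(1,2)] kron_vec_index[OF assms(3,4)])
  also have "\<dots> = (A *\<^sub>v x) $ (i div c) * (B *\<^sub>v y) $ (i mod c)"
    using i by (simp only: mult_mat_vec_index[OF assms(1,3)] mult_mat_vec_index[OF assms(2,4)] div_mod_less sum_product_div_mod)
  also have "\<dots> = kron_vec (A *\<^sub>v x) (B *\<^sub>v y) $ i"
    using i c by (simp add: kron_vec_index)
  finally show "(kron A B *\<^sub>v kron_vec x y) $ i = kron_vec (A *\<^sub>v x) (B *\<^sub>v y) $ i" .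
qed

lemma kron_vec_cscalar_prod:
  fixes x y x' y' :: "complex vec"
  assumes "x \<in> carrier_vec a" "y \<in> carrier_vec b" "x' \<in> carrier_vec a" "y' \<in> carrier_vec b"
  shows "kron_vec x y \<bullet>c kron_vec x' y' = (x \<bullet>c x') * (y \<bullet>c y')"
  unfolding cscalar_prod_eq_sum[OF kron_vec_carrier[OF assms(3,4)]]
    cscalar_prod_eq_sum[OF assms(3)] cscalar_prod_eq_sum[OF assms(4)] sum_product_div_mod
  using assms by (intro sum.cong refl) (simp add: kron_vec_index mult_ac)

section \<open>Products of matrices\<close>

lemma ordered_prod_Nil: "ordered_prod q [] = 1\<^sub>m q"
  by (simp add: ordered_prod_def)

lemma ordered_prod_snoc: "ordered_prod q (As @ [A]) = A * ordered_prod q As"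
  by (simp add: ordered_prod_def)

lemma ordered_prod_carrier:
  assumes "set As \<subseteq> carrier_mat q q"
  shows "ordered_prod q As \<in> carrier_mat q q"
  using assms by (induction As rule: rev_induct) (auto simp: ordered_prod_Nil ordered_prod_snoc)

text \<open>Distributivity for a noncommutative product: multiplying out means choosing one summand
  in every factor, and a choice is a function in the extensional product. It serves twice, for
  splitting a noise into dominant and residual part and for splitting a residual into its singular
  terms.\<close>

lemma ordered_prod_mat_sum:
  assumes "\<And>s. s < k \<Longrightarrow> finite (X s)"
    and "\<And>s x. s < k \<Longrightarrow> x \<in> X s \<Longrightarrow> F s x \<in> carrier_mat q q"
  shows "ordered_prod q (map (\<lambda>s. mat_sum q (F s) (X s)) [0..<k])
    = mat_sum q (\<lambda>f. ordered_prod q (map (\<lambda>s. F s (f s)) [0..<k])) (\<Pi>\<^sub>E s\<in>{..<k}. X s)"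
  using assms
proof (induction k)
  case 0
  show ?case by (simp add: ordered_prod_Nil mat_sum_singleton)
next
  case (Suc k)
  let ?P = "\<lambda>f. ordered_prod q (map (\<lambda>s. F s (f s)) [0..<k])"
  have fin: "finite (\<Pi>\<^sub>E s\<in>{..<k}. X s)" using Suc.prems by (intro finite_PiE) auto
  have car: "?P f \<in> carrier_mat q q" if "f \<in> (\<Pi>\<^sub>E s\<in>{..<k}. X s)" for f
    using Suc.prems(2) that by (intro ordered_prod_carrier) (force simp: PiE_iff)
  \<comment> \<open>The new factor stands leftmost, so the pair of its summand \<open>y\<close> with
    \<open>g\<close> matches \<open>F k y * ?P g\<close>. Since \<open>g\<close> is extensional on
    \<open>{..<k}\<close>, the update loses no information.\<close>
  have bij: "bij_betw (\<lambda>(y, g). g(k := y)) (X k \<times> (\<Pi>\<^sub>E s\<in>{..<k}. X s)) (\<Pi>\<^sub>E s\<in>{..<Suc k}. X s)"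
    unfolding lessThan_Suc PiE_insert_eq bij_betw_def using inj_combinator[of k "{..<k}" X] by simp
  have "ordered_prod q (map (\<lambda>s. mat_sum q (F s) (X s)) [0..<Suc k])
      = mat_sum q (F k) (X k) * mat_sum q ?P (\<Pi>\<^sub>E s\<in>{..<k}. X s)"
    using Suc by (simp add: ordered_prod_snoc)
  also have "\<dots> = mat_sum q (\<lambda>(y, g). F k y * ?P g) (X k \<times> (\<Pi>\<^sub>E s\<in>{..<k}. X s))"
    using Suc.prems fin car by (intro mat_sum_mult_mat_sum) auto
  also have "\<dots> = mat_sum q (\<lambda>f. ordered_prod q (map (\<lambda>s. F s (f s)) [0..<Suc k])) (\<Pi>\<^sub>E s\<in>{..<Suc k}. X s)"
  proof (subst mat_sum_reindex[OF bij], rule mat_sum_cong)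
    fix z assume "z \<in> X k \<times> (\<Pi>\<^sub>E s\<in>{..<k}. X s)"
    obtain y g where z: "z = (y, g)" by fastforce
    have upd: "map (\<lambda>s. F s (if s = k then y else g s)) [0..<k] = map (\<lambda>s. F s (g s)) [0..<k]"
      by simp
    show "(case z of (y, g) \<Rightarrow> F k y * ?P g)
      = ordered_prod q (map (\<lambda>s. F s ((case z of (y, g) \<Rightarrow> g(k := y)) s)) [0..<Suc k])"
      by (simp add: z ordered_prod_snoc upd)
  qed
  finally show ?case .
qed

text \<open>The mixed product rule, applied factor by factor. This is the separation of the doubled
  network into two n-qubit networks.\<close>

lemma ordered_prod_kron:
  assumes "\<And>s. s \<in> set xs \<Longrightarrow> F s \<in> carrier_mat q q" "\<And>s. s \<in> set xs \<Longrightarrow> G s \<in> carrier_mat q q"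
  shows "ordered_prod (q * q) (map (\<lambda>s. kron (F s) (G s)) xs)
    = kron (ordered_prod q (map F xs)) (ordered_prod q (map G xs))"
  using assms
proof (induction xs rule: rev_induct)
  case Nil
  show ?case by (simp add: ordered_prod_Nil kron_one)
next
  case (snoc s xs)
  have "ordered_prod q (map F xs) \<in> carrier_mat q q" "ordered_prod q (map G xs) \<in> carrier_mat q q"
    using snoc.prems by (auto intro!: ordered_prod_carrier)
  with snoc show ?case by (simp add: ordered_prod_snoc kron_mult[of _ q q _ q q _ q _ q])
qed

section \<open>Operator bounds\<close>

lemma l2_norm_eq_L2_set:
  assumes "x \<in> carrier_vec m"
  shows "l2_norm x = L2_set (\<lambda>i. cmod (x $ i)) {..<m}"
  using assms by (auto simp: l2_norm_def L2_set_def)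

lemma l2_norm_nonneg [simp]: "0 \<le> l2_norm x"
  by (simp add: l2_norm_def sum_nonneg)

lemma l2_norm_square: "(l2_norm x)\<^sup>2 = (\<Sum>i<dim_vec x. (cmod (x $ i))\<^sup>2)"
  by (simp add: l2_norm_def sum_nonneg)

lemma l2_norm_add:
  assumes "x \<in> carrier_vec m" "y \<in> carrier_vec m"
  shows "l2_norm (x + y) \<le> l2_norm x + l2_norm y"
proof -
  have "l2_norm (x + y) = L2_set (\<lambda>i. cmod (x $ i + y $ i)) {..<m}"
    using assms by (simp add: l2_norm_eq_L2_set[of _ m] L2_set_def)
  also have "\<dots> \<le> L2_set (\<lambda>i. cmod (x $ i) + cmod (y $ i)) {..<m}"
    by (intro L2_set_mono) (auto intro: norm_triangle_ineq)
  also have "\<dots> \<le> l2_norm x + l2_norm y"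
    using assms by (simp add: l2_norm_eq_L2_set[of _ m] L2_set_triangle_ineq)
  finally show ?thesis .
qed

lemma l2_norm_uminus:
  assumes "x \<in> carrier_vec m"
  shows "l2_norm (- x) = l2_norm x"
  using assms by (simp add: l2_norm_def)

lemma cmod_cscalar_prod_le:
  assumes "x \<in> carrier_vec m" "y \<in> carrier_vec m"
  shows "cmod (x \<bullet>c y) \<le> l2_norm x * l2_norm y"
proof -
  have "cmod (x \<bullet>c y) \<le> (\<Sum>i<m. \<bar>cmod (x $ i)\<bar> * \<bar>cmod (y $ i)\<bar>)"
    unfolding cscalar_prod_eq_sum[OF assms(2)]
    by (rule order_trans[OF norm_sum]) (simp add: norm_mult)
  also have "\<dots> \<le> l2_norm x * l2_norm y"
    unfolding l2_norm_eq_L2_set[OF assms(1)] l2_norm_eq_L2_set[OF assms(2)] by (rule L2_set_mult_ineq)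
  finally show ?thesis .
qed

text \<open>Any admissible constant instead of the least one: bounds of sums and products combine
  without suprema, and a constant may be weakened at any point.\<close>

definition op_bound :: "complex mat \<Rightarrow> real \<Rightarrow> bool" where
  "op_bound A c \<longleftrightarrow> (\<forall>x\<in>carrier_vec (dim_col A). l2_norm (A *\<^sub>v x) \<le> c * l2_norm x)"

lemma op_boundD:
  assumes "op_bound A c" "A \<in> carrier_mat a b" "x \<in> carrier_vec b"
  shows "l2_norm (A *\<^sub>v x) \<le> c * l2_norm x"
  using assms by (auto simp: op_bound_def)

lemma op_bound_mono:
  assumes "op_bound A c" "c \<le> d"
  shows "op_bound A d"
  using assms unfolding op_bound_def
  by (meson l2_norm_nonneg mult_right_mono order_trans)

lemma op_bound_add:
  assumes "A \<in> carrier_mat a b" "B \<in> carrier_mat a b" "op_bound A c" "op_bound B d"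
  shows "op_bound (A + B) (c + d)"
  unfolding op_bound_def
proof
  fix x :: "complex vec" assume "x \<in> carrier_vec (dim_col (A + B))"
  then have x: "x \<in> carrier_vec b" using assms by simp
  have "l2_norm ((A + B) *\<^sub>v x) \<le> l2_norm (A *\<^sub>v x) + l2_norm (B *\<^sub>v x)"
    using assms x by (subst add_mult_distrib_mat_vec[of _ a b]) (auto intro: l2_norm_add[of _ a])
  also have "\<dots> \<le> c * l2_norm x + d * l2_norm x"
    using assms x by (intro add_mono op_boundD)
  finally show "l2_norm ((A + B) *\<^sub>v x) \<le> (c + d) * l2_norm x" by (simp add: algebra_simps)
qed

lemma op_bound_uminus:
  assumes "A \<in> carrier_mat a b" "op_bound A c"
  shows "op_bound (- A) c"
  unfolding op_bound_def
proof
  fix x :: "complex vec" assume "x \<in> carrier_vec (dim_col (- A))"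
  then have x: "x \<in> carrier_vec b" using assms by simp
  have "(- A) *\<^sub>v x = - (A *\<^sub>v x)"
    using assms x by (intro eq_vecI) (auto simp: scalar_prod_uminus_left)
  then show "l2_norm ((- A) *\<^sub>v x) \<le> c * l2_norm x"
    using op_boundD[OF assms(2,1) x] assms(1) x by (simp add: l2_norm_uminus[of _ a])
qed

lemma op_bound_mult:
  assumes "A \<in> carrier_mat a b" "B \<in> carrier_mat b e" "op_bound A c" "op_bound B d" "0 \<le> c"
  shows "op_bound (A * B) (c * d)"
  unfolding op_bound_def
proof
  fix x :: "complex vec" assume "x \<in> carrier_vec (dim_col (A * B))"
  then have x: "x \<in> carrier_vec e" using assms by simp
  have "l2_norm ((A * B) *\<^sub>v x) = l2_norm (A *\<^sub>v (B *\<^sub>v x))"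
    using assms x by (simp add: assoc_mult_mat_vec[of _ a b _ e])
  also have "\<dots> \<le> c * l2_norm (B *\<^sub>v x)" using assms x by (intro op_boundD[of _ _ a b]) auto
  also have "\<dots> \<le> c * (d * l2_norm x)" using assms x by (intro mult_left_mono op_boundD) auto
  finally show "l2_norm ((A * B) *\<^sub>v x) \<le> c * d * l2_norm x" by (simp add: mult_ac)
qed

lemma op_bound_one: "op_bound (1\<^sub>m q) 1"
  by (simp add: op_bound_def)

lemma op_bound_ordered_prod:
  assumes "\<And>s. s \<in> set xs \<Longrightarrow> F s \<in> carrier_mat q q"
    and "\<And>s. s \<in> set xs \<Longrightarrow> op_bound (F s) (c s)" "\<And>s. s \<in> set xs \<Longrightarrow> 0 \<le> c s"
  shows "op_bound (ordered_prod q (map F xs)) (prod_list (map c xs))"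
  using assms
proof (induction xs rule: rev_induct)
  case (snoc s xs)
  have "ordered_prod q (map F xs) \<in> carrier_mat q q"
    using snoc.prems by (auto intro!: ordered_prod_carrier)
  then have "op_bound (F s * ordered_prod q (map F xs)) (c s * prod_list (map c xs))"
    using snoc by (intro op_bound_mult[of _ q q _ q]) auto
  then show ?case by (simp add: ordered_prod_snoc mult.commute)
qed (simp add: ordered_prod_Nil op_bound_one)

text \<open>The hypothesis \<open>iso\<close> says that the columns of \<open>A\<close> are
  orthonormal, so the squared norm of the image, expanded over pairs of columns, keeps only the
  diagonal pairs.\<close>

lemma op_bound_isometry:
  assumes A: "A \<in> carrier_mat q q" and iso: "mat_adjoint A * A = 1\<^sub>m q"
  shows "op_bound A 1"
  unfolding op_bound_def
proof
  fix x :: "complex vec" assume "x \<in> carrier_vec (dim_col A)"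
  then have x: "x \<in> carrier_vec q" using A by simp
  have delta: "(\<Sum>i<q. A $$ (i, k) * cnj (A $$ (i, l))) = (if l = k then 1 else 0)" if "k < q" "l < q" for k l
  proof -
    have "(\<Sum>i<q. A $$ (i, k) * cnj (A $$ (i, l))) = (mat_adjoint A * A) $$ (l, k)"
      unfolding mult_mat_index[OF mat_adjoint_carrier[OF A] A that(2,1)]
      by (intro sum.cong refl) (simp add: mat_adjoint_index[OF A] that)
    then show ?thesis using that by (simp add: iso)
  qed
  have "complex_of_real ((l2_norm (A *\<^sub>v x))\<^sup>2) = (\<Sum>i<q. (A *\<^sub>v x) $ i * cnj ((A *\<^sub>v x) $ i))"
    using A by (simp add: l2_norm_square complex_norm_square del: of_real_power index_mult_mat_vec)
  also have "\<dots> = (\<Sum>i<q. \<Sum>k<q. \<Sum>l<q. A $$ (i, k) * x $ k * (cnj (A $$ (i, l)) * cnj (x $ l)))"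
    by (intro sum.cong refl) (simp add: mult_mat_vec_index[OF A x] sum_product del: index_mult_mat_vec)
  also have "\<dots> = (\<Sum>k<q. \<Sum>i<q. \<Sum>l<q. A $$ (i, k) * x $ k * (cnj (A $$ (i, l)) * cnj (x $ l)))"
    by (rule sum.swap)
  also have "\<dots> = (\<Sum>k<q. \<Sum>l<q. \<Sum>i<q. A $$ (i, k) * x $ k * (cnj (A $$ (i, l)) * cnj (x $ l)))"
    by (intro sum.cong refl sum.swap)
  also have "\<dots> = (\<Sum>k<q. \<Sum>l<q. x $ k * cnj (x $ l) * (\<Sum>i<q. A $$ (i, k) * cnj (A $$ (i, l))))"
    by (simp add: sum_distrib_left mult_ac)
  also have "\<dots> = (\<Sum>k<q. \<Sum>l<q. if l = k then x $ k * cnj (x $ k) else 0)"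
    by (intro sum.cong refl) (simp add: delta)
  also have "\<dots> = complex_of_real ((l2_norm x)\<^sup>2)"
    using x by (simp add: l2_norm_square complex_norm_square del: of_real_power)
  finally have "(l2_norm (A *\<^sub>v x))\<^sup>2 = (l2_norm x)\<^sup>2" by (simp only: of_real_eq_iff)
  then show "l2_norm (A *\<^sub>v x) \<le> 1 * l2_norm x" by simp
qed

section \<open>Frobenius norm against operator norm\<close>

definition frobenius_square :: "complex mat \<Rightarrow> real" where
  "frobenius_square A = (\<Sum>i<dim_row A. \<Sum>j<dim_col A. (cmod (A $$ (i, j)))\<^sup>2)"

lemma frobenius_square_nonneg [simp]: "0 \<le> frobenius_square A"
  by (simp add: frobenius_square_def sum_nonneg)

text \<open>Cauchy-Schwarz in each row.\<close>

lemma op_bound_frobenius: "op_bound A (sqrt (frobenius_square A))"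
  unfolding op_bound_def
proof
  fix x :: "complex vec" assume x: "x \<in> carrier_vec (dim_col A)"
  let ?a = "dim_row A" let ?b = "dim_col A"
  have row: "(cmod ((A *\<^sub>v x) $ i))\<^sup>2 \<le> (\<Sum>j<?b. (cmod (A $$ (i, j)))\<^sup>2) * (l2_norm x)\<^sup>2" if "i < ?a" for i
  proof -
    have "cmod ((A *\<^sub>v x) $ i) \<le> (\<Sum>j<?b. \<bar>cmod (A $$ (i, j))\<bar> * \<bar>cmod (x $ j)\<bar>)"
      unfolding mult_mat_vec_index[OF carrier_matI[OF refl refl] x that]
      by (rule order_trans[OF norm_sum]) (simp add: norm_mult)
    also have "\<dots> \<le> L2_set (\<lambda>j. cmod (A $$ (i, j))) {..<?b} * l2_norm x"
      unfolding l2_norm_eq_L2_set[OF x] by (rule L2_set_mult_ineq)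
    finally have "(cmod ((A *\<^sub>v x) $ i))\<^sup>2 \<le> (L2_set (\<lambda>j. cmod (A $$ (i, j))) {..<?b} * l2_norm x)\<^sup>2"
      by (intro power_mono) auto
    then show ?thesis by (simp add: power_mult_distrib L2_set_def sum_nonneg)
  qed
  have "(l2_norm (A *\<^sub>v x))\<^sup>2 \<le> (\<Sum>i<?a. (\<Sum>j<?b. (cmod (A $$ (i, j)))\<^sup>2) * (l2_norm x)\<^sup>2)"
    unfolding l2_norm_square[of "A *\<^sub>v x"] dim_mult_mat_vec
    by (intro sum_mono) (simp add: row del: index_mult_mat_vec)
  also have "\<dots> = (sqrt (frobenius_square A) * l2_norm x)\<^sup>2"
    by (simp add: frobenius_square_def power_mult_distrib sum_nonneg sum_distrib_right)
  finally show "l2_norm (A *\<^sub>v x) \<le> sqrt (frobenius_square A) * l2_norm x"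
    by (rule power2_le_imp_le) simp
qed

text \<open>A supremum of reals bounds its members only if the set is bounded above; the Frobenius
  bound provides this.\<close>

lemma l2_norm_le_spectral_norm:
  assumes "A \<in> carrier_mat a b" "x \<in> carrier_vec b" "l2_norm x \<le> 1"
  shows "l2_norm (A *\<^sub>v x) \<le> spectral_norm A"
proof -
  have "l2_norm (A *\<^sub>v y) \<le> sqrt (frobenius_square A)"
    if "y \<in> carrier_vec (dim_col A)" "l2_norm y \<le> 1" for y
  proof -
    have "l2_norm (A *\<^sub>v y) \<le> sqrt (frobenius_square A) * l2_norm y"
      using op_bound_frobenius[of A] that(1) by (simp add: op_bound_def)
    also have "\<dots> \<le> sqrt (frobenius_square A) * 1" using that by (intro mult_left_mono) auto
    finally show ?thesis by simp
  qed
  then have "bdd_above ((\<lambda>x. l2_norm (A *\<^sub>v x)) ` {x \<in> carrier_vec (dim_col A). l2_norm x \<le> 1})"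
    by (auto intro!: bdd_aboveI2)
  then show ?thesis unfolding spectral_norm_def using assms by (intro cSUP_upper) auto
qed

lemma spectral_norm_nonneg: "0 \<le> spectral_norm A"
proof -
  have "l2_norm (0\<^sub>v (dim_col A)) \<le> 1" by (simp add: l2_norm_def)
  then have "l2_norm (A *\<^sub>v 0\<^sub>v (dim_col A)) \<le> spectral_norm A"
    by (intro l2_norm_le_spectral_norm[of _ "dim_row A" "dim_col A"]) auto
  then show ?thesis by (meson l2_norm_nonneg order_trans)
qed

text \<open>Each column of \<open>A\<close> is the image of a unit vector, so its length is at most
  the norm, and \<open>b\<close> counts the columns. For a noise \<open>b\<close> is
  \<open>q * q\<close>, which after taking roots is the origin of the factor
  \<open>q\<close>.\<close>

lemma frobenius_square_le_spectral_norm: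
  assumes A: "A \<in> carrier_mat a b"
  shows "frobenius_square A \<le> real b * (spectral_norm A)\<^sup>2"
proof -
  have "(\<Sum>i<a. (cmod (A $$ (i, j)))\<^sup>2) \<le> (spectral_norm A)\<^sup>2" if j: "j < b" for j
  proof -
    have u: "l2_norm (unit_vec b j) = 1"
    proof -
      have "(\<Sum>i<b. (cmod (unit_vec b j $ i))\<^sup>2) = (\<Sum>i<b. if i = j then 1 else 0)"
        using j by (intro sum.cong) (auto simp: unit_vec_def)
      then show ?thesis using j by (simp add: l2_norm_def)
    qed
    have "(\<Sum>i<a. (cmod (A $$ (i, j)))\<^sup>2) = (l2_norm (A *\<^sub>v unit_vec b j))\<^sup>2"
      using A j by (simp add: l2_norm_square)
    also have "\<dots> \<le> (spectral_norm A)\<^sup>2"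
      using u by (intro power_mono l2_norm_le_spectral_norm[OF A]) auto
    finally show ?thesis .
  qed
  then have "(\<Sum>j<b. \<Sum>i<a. (cmod (A $$ (i, j)))\<^sup>2) \<le> (\<Sum>j<b. (spectral_norm A)\<^sup>2)"
    by (intro sum_mono) auto
  then show ?thesis using A unfolding frobenius_square_def by (subst sum.swap) auto
qed

section \<open>Local operators\<close>

text \<open>Binary digits in Horner form, least significant first; the rules for bits of
  \<open>horner_sum\<close> then determine every bit of a local index.\<close>

lemma local_index_eq_horner_sum: "local_index ks x = horner_sum of_bool 2 (map (bit x) ks)"
  by (simp add: local_index_def horner_sum_eq_sum lessThan_atLeast0)

lemma bit_local_index_iff: "bit (local_index ks x) i \<longleftrightarrow> i < length ks \<and> bit x (ks ! i)"
  by (auto simp: local_index_eq_horner_sum bit_horner_sum_bit_iff)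

lemma local_index_less: "local_index ks x < 2 ^ length ks"
  using horner_sum_of_bool_2_less[of "map (bit x) ks", where ?'a = nat] by (simp add: local_index_eq_horner_sum)

lemma nat_eqI_bits:
  fixes x y :: nat
  assumes "x < 2 ^ m" "y < 2 ^ m" "\<And>k. k < m \<Longrightarrow> bit x k = bit y k"
  shows "x = y"
proof -
  have "take_bit m x = take_bit m y" using assms(3) by (auto intro!: bit_eqI simp: bit_simps)
  then show ?thesis using assms(1,2) by (simp add: take_bit_nat_eq_self_iff[THEN iffD2])
qed

text \<open>The support condition of \<open>extend\<close>. For fixed \<open>m\<close> and
  \<open>ks\<close> it is an equivalence relation; its classes are the blocks that an extended
  operator preserves.\<close>

definition agree_off :: "nat \<Rightarrow> nat list \<Rightarrow> nat \<Rightarrow> nat \<Rightarrow> bool" where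
  "agree_off m ks x y \<longleftrightarrow> (\<forall>k<m. k \<notin> set ks \<longrightarrow> bit x k = bit y k)"

text \<open>Within a class the bits outside \<open>ks\<close> are frozen to those of
  \<open>y\<close> and the bits at \<open>ks\<close> are free, so the local index is a coordinate on
  the class.\<close>

lemma bij_betw_local_index:
  assumes "distinct ks" "set ks \<subseteq> {..<m}"
  shows "bij_betw (local_index ks) {x \<in> {..<2 ^ m}. agree_off m ks y x} {..<2 ^ length ks}"
proof (intro bij_betw_imageI inj_onI)
  fix x x' assume x: "x \<in> {x \<in> {..<2 ^ m}. agree_off m ks y x}" "x' \<in> {x \<in> {..<2 ^ m}. agree_off m ks y x}"
    and eq: "local_index ks x = local_index ks x'"
  show "x = x'"
  proof (rule nat_eqI_bits[of _ m])
    fix k assume k: "k < m"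
    show "bit x k = bit x' k"
    proof (cases "k \<in> set ks")
      case True
      then obtain i where "i < length ks" "ks ! i = k" by (auto simp: in_set_conv_nth)
      then show ?thesis using bit_local_index_iff[of ks x i] bit_local_index_iff[of ks x' i] eq by simp
    next
      case False
      then show ?thesis using x k by (auto simp: agree_off_def)
    qed
  qed (use x in auto)
next
  show "local_index ks ` {x \<in> {..<2 ^ m}. agree_off m ks y x} = {..<2 ^ length ks}" (is "?L = ?R")
  proof
    show "?L \<subseteq> ?R" using local_index_less by auto
    show "?R \<subseteq> ?L"
    proof
      fix a :: nat assume a: "a \<in> {..<2 ^ length ks}"
      \<comment> \<open>Bits of the preimage of \<open>a\<close>: those of \<open>a\<close> are
        written to the positions in \<open>ks\<close>, and the remaining positions copy
        \<open>y\<close>. Distinctness of \<open>ks\<close> makes the index \<open>i\<close> of a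
        position unique.\<close>
      define bs where
        "bs = map (\<lambda>k. if k \<in> set ks then \<exists>i<length ks. ks ! i = k \<and> bit a i else bit y k) [0..<m]"
      define x :: nat where "x = horner_sum of_bool 2 bs"
      have x: "x < 2 ^ m" using horner_sum_of_bool_2_less[of bs, where ?'a = nat] by (simp add: x_def bs_def)
      have bit_x: "bit x k \<longleftrightarrow> bs ! k" if "k < m" for k
        using that by (auto simp: x_def bit_horner_sum_bit_iff bs_def)
      have "local_index ks x = a"
      proof (rule nat_eqI_bits[of _ "length ks"])
        fix i assume i: "i < length ks"
        then have "ks ! i \<in> set ks" by simp
        moreover from this have "ks ! i < m" using assms(2) by auto
        ultimately show "bit (local_index ks x) i = bit a i"
          using i assms(1) by (auto simp: bit_local_index_iff bit_x bs_def nth_eq_iff_index_eq)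
      qed (use a local_index_less in auto)
      moreover have "agree_off m ks y x" by (auto simp: agree_off_def bit_x bs_def)
      ultimately show "a \<in> ?L" using x by auto
    qed
  qed
qed

lemma extend_carrier [simp]: "extend m ks A \<in> carrier_mat (2 ^ m) (2 ^ m)"
  by (simp add: extend_def)

lemma extend_index:
  assumes "x < 2 ^ m" "y < 2 ^ m"
  shows "extend m ks A $$ (x, y)
    = (if agree_off m ks x y then A $$ (local_index ks x, local_index ks y) else 0)"
  using assms by (simp add: extend_def agree_off_def)

text \<open>The computational basis is partitioned by the values of the bits outside \<open>ks\<close>; on each
  block the extension acts as \<open>A\<close>. Rather than choosing representatives, every block is counted
  once for each of its \<open>2 ^ length ks\<close> members.\<close>

lemma op_bound_extend:
  assumes ks: "distinct ks" "set ks \<subseteq> {..<m}"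
    and A: "A \<in> carrier_mat (2 ^ length ks) (2 ^ length ks)" and c: "op_bound A c" "0 \<le> c"
  shows "op_bound (extend m ks A) c"
  unfolding op_bound_def
proof
  fix x :: "complex vec" assume "x \<in> carrier_vec (dim_col (extend m ks A))"
  then have x: "x \<in> carrier_vec (2 ^ m)" by (simp add: extend_def)
  let ?R = "agree_off m ks" and ?K = "2 ^ length ks :: nat"
  define B where "B i = {j \<in> {..<2 ^ m}. ?R i j}" for i
  define z where "z = extend m ks A *\<^sub>v x"
  have z: "z \<in> carrier_vec (2 ^ m)"
    unfolding z_def by (rule mult_mat_vec_carrier[OF extend_carrier x])
  have bij: "bij_betw (local_index ks) (B i) {..<?K}" for i
    unfolding B_def by (rule bij_betw_local_index[OF ks])
  \<comment> \<open>The relation is symmetric, so the number of \<open>i\<close> with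
    \<open>j\<close> in \<open>B i\<close> is the size of \<open>B j\<close>, which is
    \<open>?K\<close> by \<open>bij\<close>.\<close>
  have count: "(\<Sum>i<2 ^ m. \<Sum>j\<in>B i. h j) = ?K * (\<Sum>j<2 ^ m. h j)" for h :: "nat \<Rightarrow> real"
  proof -
    have "(\<Sum>i<2 ^ m. \<Sum>j\<in>B i. h j) = (\<Sum>j<2 ^ m. \<Sum>i\<in>{i \<in> {..<2 ^ m}. ?R i j}. h j)"
      unfolding B_def by (rule sum.swap_restrict) auto
    also have "\<dots> = (\<Sum>j<2 ^ m. ?K * h j)"
    proof (intro sum.cong refl)
      fix j
      have "{i \<in> {..<2 ^ m}. ?R i j} = B j" by (auto simp: B_def agree_off_def)
      then show "(\<Sum>i\<in>{i \<in> {..<2 ^ m}. ?R i j}. h j) = ?K * h j"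
        using bij_betw_same_card[OF bij[of j]] by simp
    qed
    finally show ?thesis by (simp add: sum_distrib_left)
  qed
  have block: "(\<Sum>j\<in>B i. (cmod (z $ j))\<^sup>2) \<le> c\<^sup>2 * (\<Sum>j\<in>B i. (cmod (x $ j))\<^sup>2)" for i
  proof -
    \<comment> \<open>The part of \<open>x\<close> on the block of \<open>i\<close>, read as a
      vector of the local space.\<close>
    define y where "y = vec ?K (\<lambda>a. x $ inv_into (B i) (local_index ks) a)"
    have y: "y \<in> carrier_vec ?K" by (simp add: y_def)
    have y_loc: "y $ local_index ks j = x $ j" if "j \<in> B i" for j
      using that bij[of i] by (simp add: y_def local_index_less bij_betw_def)
    have Ay: "(A *\<^sub>v y) $ local_index ks k = z $ k" if k: "k \<in> B i" for k
    proof -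
      have k': "k < 2 ^ m" using k by (simp add: B_def)
      have Bk: "B i = {j \<in> {..<2 ^ m}. ?R k j}" using k by (auto simp: B_def agree_off_def)
      have "z $ k = (\<Sum>j<2 ^ m. extend m ks A $$ (k, j) * x $ j)"
        unfolding z_def by (rule mult_mat_vec_index[OF extend_carrier x k'])
      also have "\<dots> = (\<Sum>j<2 ^ m. if ?R k j then A $$ (local_index ks k, local_index ks j) * x $ j else 0)"
        using k' by (intro sum.cong refl) (simp add: extend_index)
      also have "\<dots> = (\<Sum>j\<in>B i. A $$ (local_index ks k, local_index ks j) * x $ j)"
        unfolding Bk by (rule sum.inter_filter[symmetric]) simp
      also have "\<dots> = (\<Sum>j\<in>B i. A $$ (local_index ks k, local_index ks j) * y $ local_index ks j)"
        by (simp add: y_loc)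
      also have "\<dots> = (\<Sum>a<?K. A $$ (local_index ks k, a) * y $ a)"
        by (rule sum.reindex_bij_betw[OF bij])
      also have "\<dots> = (A *\<^sub>v y) $ local_index ks k"
        by (rule mult_mat_vec_index[OF A y local_index_less, symmetric])
      finally show ?thesis by simp
    qed
    have "(\<Sum>j\<in>B i. (cmod (z $ j))\<^sup>2) = (\<Sum>j\<in>B i. (cmod ((A *\<^sub>v y) $ local_index ks j))\<^sup>2)"
      by (simp add: Ay)
    also have "\<dots> = (\<Sum>a<?K. (cmod ((A *\<^sub>v y) $ a))\<^sup>2)" by (rule sum.reindex_bij_betw[OF bij])
    also have "\<dots> = (l2_norm (A *\<^sub>v y))\<^sup>2" using A by (simp add: l2_norm_square)
    also have "\<dots> \<le> (c * l2_norm y)\<^sup>2" by (intro power_mono op_boundD[OF c(1) A y]) simp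
    also have "\<dots> = c\<^sup>2 * (\<Sum>a<?K. (cmod (y $ a))\<^sup>2)"
      using y by (simp add: power_mult_distrib l2_norm_square)
    also have "(\<Sum>a<?K. (cmod (y $ a))\<^sup>2) = (\<Sum>j\<in>B i. (cmod (y $ local_index ks j))\<^sup>2)"
      by (rule sum.reindex_bij_betw[OF bij, symmetric])
    finally show ?thesis by (simp add: y_loc)
  qed
  \<comment> \<open>Summing the block estimate over all \<open>i\<close> counts every entry
    \<open>?K\<close> times on both sides, so this factor cancels.\<close>
  have "real ?K * (\<Sum>j<2 ^ m. (cmod (z $ j))\<^sup>2) \<le> (\<Sum>i<2 ^ m. c\<^sup>2 * (\<Sum>j\<in>B i. (cmod (x $ j))\<^sup>2))"
    unfolding count[symmetric] by (intro sum_mono block)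
  also have "\<dots> = real ?K * (c\<^sup>2 * (\<Sum>j<2 ^ m. (cmod (x $ j))\<^sup>2))"
    unfolding sum_distrib_left[symmetric] count by (simp add: mult_ac)
  finally have "(l2_norm z)\<^sup>2 \<le> (c * l2_norm x)\<^sup>2"
    using x z by (simp add: l2_norm_square power_mult_distrib)
  then show "l2_norm (extend m ks A *\<^sub>v x) \<le> c * l2_norm x"
    unfolding z_def by (rule power2_le_imp_le) (simp add: c(2))
qed

lemma extend_mat_sum:
  assumes "q = 2 ^ length ks"
  shows "extend m ks (mat_sum q F I) = mat_sum (2 ^ m) (\<lambda>x. extend m ks (F x)) I"
proof (rule eq_matI)
  fix x y assume "x < dim_row (mat_sum (2 ^ m) (\<lambda>x. extend m ks (F x)) I)"
    "y < dim_col (mat_sum (2 ^ m) (\<lambda>x. extend m ks (F x)) I)"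
  then have "x < 2 ^ m" "y < 2 ^ m" by (auto simp: mat_sum_def)
  then show "extend m ks (mat_sum q F I) $$ (x, y)
      = mat_sum (2 ^ m) (\<lambda>x. extend m ks (F x)) I $$ (x, y)"
    using assms by (simp add: extend_index mat_sum_index local_index_less)
qed (auto simp: mat_sum_def extend_def)

section \<open>Local operators on two copies of the register\<close>

lemma local_index_cong:
  assumes "\<And>k. k \<in> set ks \<Longrightarrow> bit x k = bit y k"
  shows "local_index ks x = local_index ks y"
proof -
  have "map (bit x) ks = map (bit y) ks" using assms by simp
  then show ?thesis unfolding local_index_eq_horner_sum by (rule arg_cong)
qed

lemma bit_mod_power: "k < n \<Longrightarrow> bit (x mod 2 ^ n) k = bit (x :: nat) k"
  by (simp add: bit_take_bit_iff flip: take_bit_eq_mod)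

lemma bit_div_power: "bit (x div 2 ^ n) k = bit (x :: nat) (n + k)"
  by (simp add: bit_drop_bit_eq flip: drop_bit_eq_div)

text \<open>\<open>doubled\<close> lists the qubits of the second copy first, so they supply the low
  \<open>length ks\<close> bits and those of the first copy the high ones. This is the index
  encoding of \<open>kron\<close>.\<close>

lemma local_index_doubled:
  assumes "set ks \<subseteq> {..<n}"
  shows "local_index (doubled n ks) x
    = local_index ks (x div 2 ^ n) * 2 ^ length ks + local_index ks (x mod 2 ^ n)"
proof -
  have "local_index ks (x mod 2 ^ n) = local_index ks x"
    using assms by (intro local_index_cong bit_mod_power) auto
  moreover have "map (bit x) (map (\<lambda>k. n + k) ks) = map (bit (x div 2 ^ n)) ks"
    by (simp add: bit_div_power)
  ultimately show ?thesis
    by (simp add: local_index_eq_horner_sum doubled_def horner_sum_append del: map_map)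
qed

lemma agree_off_doubled:
  assumes "set ks \<subseteq> {..<n}"
  shows "agree_off (2 * n) (doubled n ks) x y
    \<longleftrightarrow> agree_off n ks (x div 2 ^ n) (y div 2 ^ n) \<and> agree_off n ks (x mod 2 ^ n) (y mod 2 ^ n)"
    (is "?L \<longleftrightarrow> ?R")
proof
  assume L: ?L
  have "bit x (n + k) = bit y (n + k)" if "k < n" "k \<notin> set ks" for k
  proof -
    have "n + k \<notin> set (doubled n ks)" using that assms by (auto simp: doubled_def)
    then show ?thesis using L that by (auto simp: agree_off_def)
  qed
  moreover have "bit x k = bit y k" if "k < n" "k \<notin> set ks" for k
  proof -
    have "k \<notin> set (doubled n ks)" using that by (auto simp: doubled_def)
    then show ?thesis using L that by (auto simp: agree_off_def)
  qed
  ultimately show ?R by (simp add: agree_off_def bit_div_power bit_mod_power)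
next
  assume R: ?R
  have "bit x k = bit y k" if k: "k < 2 * n" "k \<notin> set (doubled n ks)" for k
  proof (cases "k < n")
    case True
    then show ?thesis using R k by (auto simp: agree_off_def bit_mod_power doubled_def)
  next
    case False
    then obtain l where "k = n + l" by (metis le_Suc_ex not_less)
    then show ?thesis using R k by (auto simp: agree_off_def bit_div_power doubled_def)
  qed
  then show ?L by (simp add: agree_off_def)
qed

text \<open>Both sides have the same support condition by \<open>agree_off_doubled\<close>, and on
  it the doubled local index splits by \<open>div\<close> and \<open>mod\<close> into the local
  indices of the two copies.\<close>

lemma extend_doubled_kron:
  assumes ks: "set ks \<subseteq> {..<n}" and q: "q = 2 ^ length ks"
    and A: "A \<in> carrier_mat q q" and B: "B \<in> carrier_mat q q"
  shows "extend (2 * n) (doubled n ks) (kron A B) = kron (extend n ks A) (extend n ks B)"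
proof (rule eq_matI)
  have pow: "(2::nat) ^ (2 * n) = 2 ^ n * 2 ^ n" by (simp add: mult_2 power_add)
  show "dim_row (extend (2 * n) (doubled n ks) (kron A B)) = dim_row (kron (extend n ks A) (extend n ks B))"
    "dim_col (extend (2 * n) (doubled n ks) (kron A B)) = dim_col (kron (extend n ks A) (extend n ks B))"
    by (simp_all add: extend_def kron_def pow)
  fix x y assume "x < dim_row (kron (extend n ks A) (extend n ks B))"
    "y < dim_col (kron (extend n ks A) (extend n ks B))"
  then have xy: "x < 2 ^ n * 2 ^ n" "y < 2 ^ n * 2 ^ n" by (auto simp: extend_def kron_def)
  have lt: "local_index ks a < q" for a using q local_index_less by simp
  have ltd: "local_index (doubled n ks) a < q * q" for a
    using local_index_less[of "doubled n ks" a] by (simp add: doubled_def q power_add)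
  have "q \<noteq> 0" by (simp add: q)
  then have dm: "local_index (doubled n ks) a div q = local_index ks (a div 2 ^ n)"
    "local_index (doubled n ks) a mod q = local_index ks (a mod 2 ^ n)" for a
    using lt[of "a mod 2 ^ n"] by (simp_all add: local_index_doubled[OF ks] flip: q)
  have "extend (2 * n) (doubled n ks) (kron A B) $$ (x, y)
    = (if agree_off (2 * n) (doubled n ks) x y
       then kron A B $$ (local_index (doubled n ks) x, local_index (doubled n ks) y) else 0)"
    using xy by (intro extend_index) (simp_all add: pow)
  also have "\<dots> = (if agree_off (2 * n) (doubled n ks) x y
       then A $$ (local_index ks (x div 2 ^ n), local_index ks (y div 2 ^ n))
          * B $$ (local_index ks (x mod 2 ^ n), local_index ks (y mod 2 ^ n)) else 0)"
    unfolding kron_index[OF A B ltd ltd] by (simp add: dm)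
  also have "\<dots> = kron (extend n ks A) (extend n ks B) $$ (x, y)"
    unfolding kron_index[OF extend_carrier extend_carrier xy]
    using div_mod_less[OF xy(1)] div_mod_less[OF xy(2)]
    by (simp add: extend_index agree_off_doubled[OF ks])
  finally show "extend (2 * n) (doubled n ks) (kron A B) $$ (x, y)
    = kron (extend n ks A) (extend n ks B) $$ (x, y)" .
qed

section \<open>The singular value decomposition of a noise\<close>

lemma unitary_mat_cols:
  assumes "unitary_mat m S" "j < m" "k < m"
  shows "(\<Sum>i<m. S $$ (i, j) * cnj (S $$ (i, k))) = (if j = k then 1 else 0)"
proof -
  have S: "S \<in> carrier_mat m m" "mat_adjoint S * S = 1\<^sub>m m" using assms(1) by (auto simp: unitary_mat_def)
  have "(\<Sum>i<m. S $$ (i, j) * cnj (S $$ (i, k))) = (mat_adjoint S * S) $$ (k, j)"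
    unfolding mult_mat_index[OF mat_adjoint_carrier[OF S(1)] S(1) assms(3,2)]
    by (intro sum.cong refl) (simp add: mat_adjoint_index[OF S(1)] assms)
  then show ?thesis using assms(2,3) by (simp add: S(2))
qed

lemma unitary_mat_rows:
  assumes "unitary_mat m S" "i < m" "k < m"
  shows "(\<Sum>j<m. S $$ (i, j) * cnj (S $$ (k, j))) = (if i = k then 1 else 0)"
proof -
  have S: "S \<in> carrier_mat m m" "S * mat_adjoint S = 1\<^sub>m m" using assms(1) by (auto simp: unitary_mat_def)
  have "(\<Sum>j<m. S $$ (i, j) * cnj (S $$ (k, j))) = (S * mat_adjoint S) $$ (i, k)"
    unfolding mult_mat_index[OF S(1) mat_adjoint_carrier[OF S(1)] assms(2,3)]
    by (intro sum.cong refl) (simp add: mat_adjoint_index[OF S(1)] assms)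
  then show ?thesis using assms(2,3) by (simp add: S(2))
qed

text \<open>Up to conjugation, the inner sums are the coordinates of the real vector
  \<open>w\<close> in the orthonormal basis of columns of \<open>S\<close>. Completeness of this
  basis is the orthonormality of the rows, which is what the proof uses.\<close>

lemma unitary_mat_parseval:
  fixes w :: "nat \<Rightarrow> real"
  assumes "unitary_mat m S"
  shows "(\<Sum>j<m. (cmod (\<Sum>i<m. S $$ (i, j) * w i))\<^sup>2) = (\<Sum>i<m. (w i)\<^sup>2)"
proof -
  have "complex_of_real (\<Sum>j<m. (cmod (\<Sum>i<m. S $$ (i, j) * w i))\<^sup>2)
      = (\<Sum>j<m. \<Sum>i<m. \<Sum>k<m. (S $$ (i, j) * w i) * (cnj (S $$ (k, j)) * w k))"
    by (simp add: complex_norm_square sum_product del: of_real_power)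
  also have "\<dots> = (\<Sum>i<m. \<Sum>j<m. \<Sum>k<m. (S $$ (i, j) * w i) * (cnj (S $$ (k, j)) * w k))"
    by (rule sum.swap)
  also have "\<dots> = (\<Sum>i<m. \<Sum>k<m. \<Sum>j<m. (S $$ (i, j) * w i) * (cnj (S $$ (k, j)) * w k))"
    by (intro sum.cong refl sum.swap)
  also have "\<dots> = (\<Sum>i<m. \<Sum>k<m. w i * w k * (\<Sum>j<m. S $$ (i, j) * cnj (S $$ (k, j))))"
    by (simp add: sum_distrib_left mult_ac)
  also have "\<dots> = (\<Sum>i<m. \<Sum>k<m. if i = k then complex_of_real (w i * w i) else 0)"
    by (intro sum.cong refl) (simp add: unitary_mat_rows[OF assms])
  also have "\<dots> = complex_of_real (\<Sum>i<m. (w i)\<^sup>2)"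
    by (simp add: power2_eq_square)
  finally show ?thesis by (simp only: of_real_eq_iff)
qed

text \<open>The rank one matrices with entries \<open>S $$ (i, j) * cnj (T $$ (k, j))\<close> are
  orthonormal for the Frobenius inner product, being products of two orthonormal families.
  \<open>J\<close> will be both the full range and the tail from 1 on.\<close>

lemma svd_partial_sum_square:
  fixes d :: "nat \<Rightarrow> real"
  assumes "unitary_mat m S" "unitary_mat m T" "J \<subseteq> {..<m}"
  shows "(\<Sum>i<m. \<Sum>k<m. (cmod (\<Sum>j\<in>J. d j * S $$ (i, j) * cnj (T $$ (k, j))))\<^sup>2) = (\<Sum>j\<in>J. (d j)\<^sup>2)"
proof -
  have fin: "finite J" using assms(3) finite_subset by blast
  let ?t = "\<lambda>i k j l. (d j * S $$ (i, j) * cnj (T $$ (k, j))) * (d l * cnj (S $$ (i, l)) * T $$ (k, l))"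
  have "complex_of_real (\<Sum>i<m. \<Sum>k<m. (cmod (\<Sum>j\<in>J. d j * S $$ (i, j) * cnj (T $$ (k, j))))\<^sup>2)
      = (\<Sum>i<m. \<Sum>k<m. \<Sum>j\<in>J. \<Sum>l\<in>J. ?t i k j l)"
    by (simp add: complex_norm_square sum_product del: of_real_power)
  also have "\<dots> = (\<Sum>i<m. \<Sum>j\<in>J. \<Sum>k<m. \<Sum>l\<in>J. ?t i k j l)"
    by (intro sum.cong refl sum.swap)
  also have "\<dots> = (\<Sum>j\<in>J. \<Sum>i<m. \<Sum>k<m. \<Sum>l\<in>J. ?t i k j l)"
    by (rule sum.swap)
  also have "\<dots> = (\<Sum>j\<in>J. \<Sum>i<m. \<Sum>l\<in>J. \<Sum>k<m. ?t i k j l)"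
    by (intro sum.cong refl sum.swap)
  also have "\<dots> = (\<Sum>j\<in>J. \<Sum>l\<in>J. \<Sum>i<m. \<Sum>k<m. ?t i k j l)"
    by (intro sum.cong refl sum.swap)
  also have "\<dots> = (\<Sum>j\<in>J. \<Sum>l\<in>J. d j * d l * ((\<Sum>i<m. S $$ (i, j) * cnj (S $$ (i, l)))
      * (\<Sum>k<m. T $$ (k, l) * cnj (T $$ (k, j)))))"
    unfolding sum_product by (intro sum.cong refl) (simp add: sum_distrib_left mult_ac)
  also have "\<dots> = (\<Sum>j\<in>J. \<Sum>l\<in>J. if j = l then complex_of_real (d j * d j) else 0)"
  proof (intro sum.cong refl)
    fix j l assume "j \<in> J" "l \<in> J"
    then have "j < m" "l < m" using assms(3) by auto
    then show "d j * d l * ((\<Sum>i<m. S $$ (i, j) * cnj (S $$ (i, l)))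
        * (\<Sum>k<m. T $$ (k, l) * cnj (T $$ (k, j)))) = (if j = l then complex_of_real (d j * d j) else 0)"
      by (simp add: unitary_mat_cols[OF assms(1)] unitary_mat_cols[OF assms(2)])
  qed
  also have "\<dots> = complex_of_real (\<Sum>j\<in>J. (d j)\<^sup>2)"
    using fin by (simp add: power2_eq_square)
  finally show ?thesis by (simp only: of_real_eq_iff)
qed

text \<open>The case of the Eckart-Young theorem in which the rank one matrix is \<open>w w\<^sup>T\<close>: the squared
  distance is at least \<open>\<Sum>j. (d j)\<^sup>2 - 2 * d 0 * W + W\<^sup>2\<close> with \<open>W = \<Sum>i. (w i)\<^sup>2\<close>.\<close>

lemma svd_tail_le_distance:
  fixes d w :: "nat \<Rightarrow> real"
  assumes S: "unitary_mat m S" and T: "unitary_mat m T" and m: "0 < m"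
    and d: "\<And>j. j < m \<Longrightarrow> 0 \<le> d j \<and> d j \<le> d 0"
  shows "(\<Sum>j\<in>{1..<m}. (d j)\<^sup>2)
    \<le> (\<Sum>i<m. \<Sum>k<m. (cmod ((\<Sum>j<m. d j * S $$ (i, j) * cnj (T $$ (k, j))) - complex_of_real (w i * w k)))\<^sup>2)"
proof -
  define A where "A i k = (\<Sum>j<m. d j * S $$ (i, j) * cnj (T $$ (k, j)))" for i k
  define W where "W = (\<Sum>i<m. (w i)\<^sup>2)"
  \<comment> \<open>Up to conjugation, \<open>a\<close> and \<open>b\<close> are the coordinates of
    \<open>w\<close> in the bases of left and right singular vectors.\<close>
  define a where "a j = (\<Sum>i<m. S $$ (i, j) * w i)" for j
  define b where "b j = (\<Sum>k<m. T $$ (k, j) * w k)" for j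
  have "(\<Sum>i<m. \<Sum>k<m. A i k * complex_of_real (w i * w k))
      = (\<Sum>i<m. \<Sum>k<m. \<Sum>j<m. d j * ((S $$ (i, j) * w i) * (cnj (T $$ (k, j)) * w k)))"
    by (simp add: A_def sum_distrib_left sum_distrib_right mult_ac)
  also have "\<dots> = (\<Sum>i<m. \<Sum>j<m. \<Sum>k<m. d j * ((S $$ (i, j) * w i) * (cnj (T $$ (k, j)) * w k)))"
    by (intro sum.cong refl sum.swap)
  also have "\<dots> = (\<Sum>j<m. \<Sum>i<m. \<Sum>k<m. d j * ((S $$ (i, j) * w i) * (cnj (T $$ (k, j)) * w k)))"
    by (rule sum.swap)
  also have "\<dots> = (\<Sum>j<m. d j * (a j * cnj (b j)))"
    by (simp add: a_def b_def sum_product) (simp add: sum_distrib_left)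
  finally have cross_eq: "(\<Sum>i<m. \<Sum>k<m. A i k * complex_of_real (w i * w k)) = (\<Sum>j<m. d j * (a j * cnj (b j)))" .
  have "Re (\<Sum>i<m. \<Sum>k<m. A i k * complex_of_real (w i * w k)) \<le> (\<Sum>j<m. cmod (d j * (a j * cnj (b j))))"
    unfolding cross_eq by (rule order_trans[OF complex_Re_le_cmod norm_sum])
  \<comment> \<open>Here \<open>d 0\<close> enters as the largest singular value. The
    arithmetic-geometric mean inequality decouples \<open>a\<close> from \<open>b\<close>, so that
    Parseval can be applied to each.\<close>
  also have "\<dots> \<le> (\<Sum>j<m. d 0 * (((cmod (a j))\<^sup>2 + (cmod (b j))\<^sup>2) / 2))"
  proof (intro sum_mono)
    fix j assume "j \<in> {..<m}"
    then have dj: "0 \<le> d j" "d j \<le> d 0" using d by auto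
    have "cmod (d j * (a j * cnj (b j))) = d j * (cmod (a j) * cmod (b j))"
      using dj by (simp add: norm_mult)
    also have "\<dots> \<le> d 0 * (((cmod (a j))\<^sup>2 + (cmod (b j))\<^sup>2) / 2)"
      using dj sum_squares_bound[of "cmod (a j)" "cmod (b j)"] by (intro mult_mono) auto
    finally show "cmod (d j * (a j * cnj (b j))) \<le> d 0 * (((cmod (a j))\<^sup>2 + (cmod (b j))\<^sup>2) / 2)" .
  qed
  also have "\<dots> = d 0 * (((\<Sum>j<m. (cmod (a j))\<^sup>2) + (\<Sum>j<m. (cmod (b j))\<^sup>2)) / 2)"
    by (simp add: sum.distrib flip: sum_distrib_left sum_divide_distrib)
  also have "\<dots> = d 0 * W"
    unfolding a_def b_def unitary_mat_parseval[OF S] unitary_mat_parseval[OF T] W_def by simp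
  finally have cross: "Re (\<Sum>i<m. \<Sum>k<m. A i k * complex_of_real (w i * w k)) \<le> d 0 * W" .
  have norm_sq: "(cmod (z - complex_of_real r))\<^sup>2 = (cmod z)\<^sup>2 - 2 * Re (z * complex_of_real r) + r\<^sup>2" for z r
    unfolding cmod_power2 by (simp add: power2_eq_square algebra_simps)
  have tail: "(\<Sum>j<m. (d j)\<^sup>2) = (d 0)\<^sup>2 + (\<Sum>j\<in>{1..<m}. (d j)\<^sup>2)"
    using m by (simp add: lessThan_atLeast0 sum.atLeast_Suc_lessThan)
  have "(\<Sum>i<m. \<Sum>k<m. (cmod (A i k - complex_of_real (w i * w k)))\<^sup>2)
      = (\<Sum>i<m. \<Sum>k<m. (cmod (A i k))\<^sup>2)
        - 2 * Re (\<Sum>i<m. \<Sum>k<m. A i k * complex_of_real (w i * w k)) + (\<Sum>i<m. \<Sum>k<m. (w i * w k)\<^sup>2)"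
    unfolding norm_sq by (simp add: sum.distrib sum_subtractf sum_distrib_left)
  also have "(\<Sum>i<m. \<Sum>k<m. (cmod (A i k))\<^sup>2) = (\<Sum>j<m. (d j)\<^sup>2)"
    unfolding A_def by (rule svd_partial_sum_square[OF S T order_refl])
  also have "(\<Sum>i<m. \<Sum>k<m. (w i * w k)\<^sup>2) = W\<^sup>2"
    unfolding W_def power2_eq_square[of "sum _ _"] sum_product by (simp add: power_mult_distrib)
  finally have "(\<Sum>i<m. \<Sum>k<m. (cmod (A i k - complex_of_real (w i * w k)))\<^sup>2)
      \<ge> (\<Sum>j\<in>{1..<m}. (d j)\<^sup>2) + (d 0 - W)\<^sup>2"
    using cross unfolding tail by (simp add: power2_diff)
  then show ?thesis unfolding A_def by (smt (verit) zero_le_power2)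
qed

lemma svd_index:
  assumes "is_svd m A (S, d, T)" "i < m" "k < m"
  shows "A $$ (i, k) = (\<Sum>j<m. d j * S $$ (i, j) * cnj (T $$ (k, j)))"
proof -
  have S: "S \<in> carrier_mat m m" and T: "T \<in> carrier_mat m m" using assms(1) by (auto simp: unitary_mat_def)
  have A: "A = mat m m (\<lambda>(i, j). complex_of_real (d j) * S $$ (i, j)) * mat_adjoint T"
    using assms(1) mat_diag_mult_right[OF S] by (simp add: mult.commute)
  show ?thesis
    unfolding A using assms(2,3)
    by (subst mult_mat_index[OF _ mat_adjoint_carrier[OF T] assms(2,3)])
      (auto intro!: sum.cong simp: mat_adjoint_index[OF T])
qed

section \<open>Undoing the tensor permutation\<close>

lemma svd_term_carrier: "kron (svd_U q w j) (svd_V q w j) \<in> carrier_mat (q * q) (q * q)"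
  by (cases w) (simp add: kron_def)

text \<open>With \<open>x\<close> and \<open>y\<close> read as pairs (a, b) and (c, e), the indices
  on the right are (a, c) and (b, e): the Kronecker product of two reshaped singular vectors is a
  rank one matrix with its indices permuted back.\<close>

lemma svd_term_index:
  assumes "x < q * q" "y < q * q"
  shows "kron (svd_U q (S, d, T) j) (svd_V q (S, d, T) j) $$ (x, y)
    = d j * S $$ ((x div q) * q + y div q, j) * cnj (T $$ ((x mod q) * q + y mod q, j))"
  using assms div_mod_less[OF assms(1)] div_mod_less[OF assms(2)]
  by (simp add: kron_index[of _ q q _ q q])

text \<open>In terms of pairs this exchanges the two middle ones of four sums. With a squared
  modulus for \<open>h\<close> it is the invariance of the Frobenius norm under the tensor
  permutation.\<close>

lemma sum_div_mod_shuffle: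
  fixes h :: "nat \<Rightarrow> nat \<Rightarrow> 'a::comm_monoid_add"
  shows "(\<Sum>x<q * q. \<Sum>y<q * q. h ((x div q) * q + y div q) ((x mod q) * q + y mod q))
    = (\<Sum>i<q * q. \<Sum>k<q * q. h i k)"
proof -
  have "(\<Sum>x<q * q. \<Sum>y<q * q. h ((x div q) * q + y div q) ((x mod q) * q + y mod q))
    = (\<Sum>a<q. \<Sum>b<q. \<Sum>c<q. \<Sum>e<q. h (a * q + c) (b * q + e))"
    unfolding sum_div_mod[of "\<lambda>c e. h (_ * q + c) (_ * q + e)" q q]
    by (rule sum_div_mod[of "\<lambda>a b. \<Sum>c<q. \<Sum>e<q. h (a * q + c) (b * q + e)" q q])
  also have "\<dots> = (\<Sum>a<q. \<Sum>c<q. \<Sum>b<q. \<Sum>e<q. h (a * q + c) (b * q + e))"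
    by (intro sum.cong refl sum.swap)
  also have "\<dots> = (\<Sum>a<q. \<Sum>c<q. \<Sum>k<q * q. h (a * q + c) k)"
    using sum_div_mod[of "\<lambda>b e. h _ (b * q + e)" q q] by simp
  also have "\<dots> = (\<Sum>i<q * q. \<Sum>k<q * q. h i k)"
    using sum_div_mod[of "\<lambda>a c. \<Sum>k<q * q. h (a * q + c) k" q q] by simp
  finally show ?thesis .
qed

text \<open>Exchanging the middle two of four indices is an involution, so the formula that defines
  \<open>tensor_perm\<close> also recovers \<open>A\<close> from it.\<close>

lemma tensor_perm_shuffle:
  assumes "x < q * q" "y < q * q"
  shows "tensor_perm q A $$ ((x div q) * q + y div q, (x mod q) * q + y mod q) = A $$ (x, y)"
  using mult_add_less[OF div_mod_less(1)[OF assms(1)] div_mod_less(1)[OF assms(2)]]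
    mult_add_less[OF div_mod_less(2)[OF assms(1)] div_mod_less(2)[OF assms(2)]]
    div_mod_less[OF assms(1)] div_mod_less[OF assms(2)]
  by (simp add: tensor_perm_def)

text \<open>The decomposition of the permuted matrix is a sum of rank one terms. Read back through
  the permutation entry by entry, it becomes the sum of all Kronecker terms, from which index 0 is
  split off.\<close>

lemma mat_eq_dominant_plus_residual:
  assumes M: "M \<in> carrier_mat (q * q) (q * q)" and svd: "is_svd (q * q) (tensor_perm q M) w" and q: "0 < q"
  shows "M = dominant q w + residual q w"
proof (rule eq_matI)
  obtain S d T where w: "w = (S, d, T)" by (cases w)
  have c: "dominant q w \<in> carrier_mat (q * q) (q * q)" "residual q w \<in> carrier_mat (q * q) (q * q)"
    by (simp_all add: dominant_def svd_term_carrier residual_def)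
  then show "dim_row M = dim_row (dominant q w + residual q w)"
    "dim_col M = dim_col (dominant q w + residual q w)" using M by auto
  fix x y assume "x < dim_row (dominant q w + residual q w)" "y < dim_col (dominant q w + residual q w)"
  then have xy: "x < q * q" "y < q * q" using c by auto
  let ?i = "(x div q) * q + y div q" and ?k = "(x mod q) * q + y mod q"
  have ik: "?i < q * q" "?k < q * q" using div_mod_less xy by (auto intro!: mult_add_less)
  have "M $$ (x, y) = (\<Sum>j<q * q. d j * S $$ (?i, j) * cnj (T $$ (?k, j)))"
    using svd_index[OF svd[unfolded w] ik] tensor_perm_shuffle[OF xy] by simp
  also have "\<dots> = (\<Sum>j<q * q. kron (svd_U q w j) (svd_V q w j) $$ (x, y))"
    by (simp only: w svd_term_index[OF xy])
  also have "\<dots> = dominant q w $$ (x, y) + residual q w $$ (x, y)"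
    using xy q by (simp add: dominant_def residual_def mat_sum_index lessThan_atLeast0 sum.atLeast_Suc_lessThan)
  finally show "M $$ (x, y) = (dominant q w + residual q w) $$ (x, y)" using xy c by simp
qed

lemma frobenius_square_residual:
  assumes M: "M \<in> carrier_mat (q * q) (q * q)" and svd: "is_svd (q * q) (tensor_perm q M) w" and q: "0 < q"
  shows "frobenius_square (residual q w) \<le> frobenius_square (M - 1\<^sub>m (q * q))"
proof -
  obtain S d T where w: "w = (S, d, T)" by (cases w)
  have S: "unitary_mat (q * q) S" and T: "unitary_mat (q * q) T"
    and d: "\<And>j. j < q * q \<Longrightarrow> 0 \<le> d j \<and> d j \<le> d 0" using svd by (auto simp: w)
  \<comment> \<open>The vectorised identity, 1 exactly at the indices that encode a pair of equal
    entries. The products \<open>e i * e k\<close> are the entries of the permuted identity, because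
    \<open>x = y\<close> exactly when quotients and remainders by \<open>q\<close> agree.\<close>
  define e :: "nat \<Rightarrow> real" where "e i = of_bool (i div q = i mod q)" for i
  have "frobenius_square (residual q w) = (\<Sum>x<q * q. \<Sum>y<q * q. (cmod (residual q w $$ (x, y)))\<^sup>2)"
    by (simp add: frobenius_square_def residual_def mat_sum_def)
  also have "\<dots> = (\<Sum>x<q * q. \<Sum>y<q * q. (cmod (\<Sum>j\<in>{1..<q * q}.
      d j * S $$ ((x div q) * q + y div q, j) * cnj (T $$ ((x mod q) * q + y mod q, j))))\<^sup>2)"
    by (intro sum.cong refl) (simp add: residual_def mat_sum_index w svd_term_index del: svd_U.simps svd_V.simps)
  also have "\<dots> = (\<Sum>i<q * q. \<Sum>k<q * q. (cmod (\<Sum>j\<in>{1..<q * q}. d j * S $$ (i, j) * cnj (T $$ (k, j))))\<^sup>2)"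
    by (rule sum_div_mod_shuffle)
  also have "\<dots> = (\<Sum>j\<in>{1..<q * q}. (d j)\<^sup>2)" by (rule svd_partial_sum_square[OF S T]) auto
  also have "\<dots> \<le> (\<Sum>i<q * q. \<Sum>k<q * q.
      (cmod ((\<Sum>j<q * q. d j * S $$ (i, j) * cnj (T $$ (k, j))) - complex_of_real (e i * e k)))\<^sup>2)"
    using q d by (intro svd_tail_le_distance[of "q * q" S T d e, OF S T]) auto
  also have "\<dots> = (\<Sum>i<q * q. \<Sum>k<q * q. (cmod (tensor_perm q M $$ (i, k) - complex_of_real (e i * e k)))\<^sup>2)"
    by (intro sum.cong refl) (simp add: svd_index[OF svd[unfolded w]])
  also have "\<dots> = (\<Sum>x<q * q. \<Sum>y<q * q.
      (cmod (tensor_perm q M $$ ((x div q) * q + y div q, (x mod q) * q + y mod q)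
        - complex_of_real (e ((x div q) * q + y div q) * e ((x mod q) * q + y mod q))))\<^sup>2)"
    by (rule sum_div_mod_shuffle[symmetric])
  also have "\<dots> = (\<Sum>x<q * q. \<Sum>y<q * q. (cmod ((M - 1\<^sub>m (q * q)) $$ (x, y)))\<^sup>2)"
  proof (intro sum.cong refl)
    fix x y assume "x \<in> {..<q * q}" "y \<in> {..<q * q}"
    then have xy: "x < q * q" "y < q * q" by auto
    have "x = y \<longleftrightarrow> x div q = y div q \<and> x mod q = y mod q"
      using div_mult_mod_eq[of x q] div_mult_mod_eq[of y q] by metis
    then have "complex_of_real (e ((x div q) * q + y div q) * e ((x mod q) * q + y mod q)) = 1\<^sub>m (q * q) $$ (x, y)"
      using xy div_mod_less[OF xy(1)] div_mod_less[OF xy(2)] by (simp add: e_def)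
    then show "(cmod (tensor_perm q M $$ ((x div q) * q + y div q, (x mod q) * q + y mod q)
        - complex_of_real (e ((x div q) * q + y div q) * e ((x mod q) * q + y mod q))))\<^sup>2
      = (cmod ((M - 1\<^sub>m (q * q)) $$ (x, y)))\<^sup>2"
      using xy M by (simp add: tensor_perm_shuffle[OF xy])
  qed
  also have "\<dots> = frobenius_square (M - 1\<^sub>m (q * q))" using M by (simp add: frobenius_square_def)
  finally show ?thesis .
qed

text \<open>The deviation \<open>?E\<close> and the residual are both measured by their Frobenius
  norms, at most \<open>real q * r\<close> each; this is the origin of \<open>2 * real q * r\<close>
  for the dominant term.\<close>

lemma op_bound_residual_dominant:
  assumes M: "M \<in> carrier_mat (q * q) (q * q)" and svd: "is_svd (q * q) (tensor_perm q M) w" and q: "0 < q"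
    and r: "spectral_norm (M - 1\<^sub>m (q * q)) \<le> r"
  shows "op_bound (residual q w) (real q * r)" "op_bound (dominant q w) (1 + 2 * real q * r)"
proof -
  let ?E = "M - 1\<^sub>m (q * q)"
  have E: "?E \<in> carrier_mat (q * q) (q * q)" using M by auto
  have r0: "0 \<le> r" using spectral_norm_nonneg r by (rule order_trans)
  have "frobenius_square ?E \<le> real (q * q) * (spectral_norm ?E)\<^sup>2"
    by (rule frobenius_square_le_spectral_norm[OF E])
  also have "\<dots> \<le> real (q * q) * r\<^sup>2"
    using r spectral_norm_nonneg by (intro mult_left_mono power_mono) auto
  finally have fE: "frobenius_square ?E \<le> (real q * r)\<^sup>2" by (simp add: power2_eq_square mult_ac)
  have sqrt_le: "sqrt (frobenius_square A) \<le> real q * r" if "frobenius_square A \<le> (real q * r)\<^sup>2" for A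
    using that r0 by (intro real_le_lsqrt) auto
  show R: "op_bound (residual q w) (real q * r)"
    using frobenius_square_residual[OF M svd q] fE
    by (intro op_bound_mono[OF op_bound_frobenius] sqrt_le) simp
  have R_car: "residual q w \<in> carrier_mat (q * q) (q * q)" by (simp add: residual_def)
  have D_car: "dominant q w \<in> carrier_mat (q * q) (q * q)" by (simp add: dominant_def svd_term_carrier)
  have "dominant q w = (1\<^sub>m (q * q) + ?E) + (- residual q w)"
    by (subst mat_eq_dominant_plus_residual[OF M svd q]) (use R_car D_car in \<open>intro eq_matI; auto\<close>)
  moreover have "op_bound ((1\<^sub>m (q * q) + ?E) + (- residual q w)) ((1 + real q * r) + real q * r)"
  proof (rule op_bound_add[of _ "q * q" "q * q"])
    have "op_bound ?E (real q * r)" by (rule op_bound_mono[OF op_bound_frobenius sqrt_le[OF fE]])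
    then show "op_bound (1\<^sub>m (q * q) + ?E) (1 + real q * r)"
      using E by (intro op_bound_add[of _ "q * q" "q * q"] op_bound_one) auto
    show "op_bound (- residual q w) (real q * r)" by (rule op_bound_uminus[OF R_car R])
  qed (use E R_car in auto)
  ultimately show "op_bound (dominant q w) (1 + 2 * real q * r)" by (simp add: algebra_simps)
qed

section \<open>The matrix representation of a circuit\<close>

lemma mat_adjoint_kron:
  assumes A: "A \<in> carrier_mat a b" and B: "B \<in> carrier_mat c d"
  shows "mat_adjoint (kron A B) = kron (mat_adjoint A) (mat_adjoint B)"
proof (rule eq_matI)
  note c = mat_adjoint_carrier[OF kron_carrier[OF A B]]
    kron_carrier[OF mat_adjoint_carrier[OF A] mat_adjoint_carrier[OF B]]
  then show "dim_row (mat_adjoint (kron A B)) = dim_row (kron (mat_adjoint A) (mat_adjoint B))"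
    "dim_col (mat_adjoint (kron A B)) = dim_col (kron (mat_adjoint A) (mat_adjoint B))" by auto
  fix i j assume "i < dim_row (kron (mat_adjoint A) (mat_adjoint B))"
    "j < dim_col (kron (mat_adjoint A) (mat_adjoint B))"
  then have ij: "i < b * d" "j < a * c" using c by auto
  show "mat_adjoint (kron A B) $$ (i, j) = kron (mat_adjoint A) (mat_adjoint B) $$ (i, j)"
    unfolding mat_adjoint_index[OF kron_carrier[OF A B] ij] kron_index[OF A B ij(2,1)]
      kron_index[OF mat_adjoint_carrier[OF A] mat_adjoint_carrier[OF B] ij]
    using div_mod_less[OF ij(1)] div_mod_less[OF ij(2)]
    by (simp add: mat_adjoint_index[OF A] mat_adjoint_index[OF B])
qed

lemma conj_mat_carrier: "A \<in> carrier_mat a b \<Longrightarrow> conj_mat A \<in> carrier_mat a b"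
  by (auto simp: conj_mat_def)

lemma conj_mat_index: "A \<in> carrier_mat a b \<Longrightarrow> i < a \<Longrightarrow> j < b \<Longrightarrow> conj_mat A $$ (i, j) = cnj (A $$ (i, j))"
  by (auto simp: conj_mat_def)

text \<open>Entrywise conjugation of the equation \<open>iso\<close>, whose right-hand side is
  real.\<close>

lemma conj_mat_isometry:
  assumes A: "A \<in> carrier_mat q q" and iso: "mat_adjoint A * A = 1\<^sub>m q"
  shows "mat_adjoint (conj_mat A) * conj_mat A = 1\<^sub>m q"
proof (rule eq_matI)
  note cA = conj_mat_carrier[OF A]
  show "dim_row (mat_adjoint (conj_mat A) * conj_mat A) = dim_row (1\<^sub>m q :: complex mat)"
    "dim_col (mat_adjoint (conj_mat A) * conj_mat A) = dim_col (1\<^sub>m q :: complex mat)"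
    using cA mat_adjoint_carrier[OF cA] by auto
  fix i j assume "i < dim_row (1\<^sub>m q :: complex mat)" "j < dim_col (1\<^sub>m q :: complex mat)"
  then have ij: "i < q" "j < q" by auto
  have "(mat_adjoint (conj_mat A) * conj_mat A) $$ (i, j) = cnj ((mat_adjoint A * A) $$ (i, j))"
    unfolding mult_mat_index[OF mat_adjoint_carrier[OF cA] cA ij] mult_mat_index[OF mat_adjoint_carrier[OF A] A ij]
    using ij by (simp add: mat_adjoint_index[OF cA] mat_adjoint_index[OF A] conj_mat_index[OF A])
  then show "(mat_adjoint (conj_mat A) * conj_mat A) $$ (i, j) = 1\<^sub>m q $$ (i, j)"
    using ij by (simp add: iso)
qed

text \<open>Gates must contribute exactly the factor 1, for the error bound must not depend on their
  number.\<close>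

lemma op_bound_kron_conj_mat:
  assumes "unitary_mat q U"
  shows "op_bound (kron U (conj_mat U)) 1"
proof (rule op_bound_isometry)
  have U: "U \<in> carrier_mat q q" and iso: "mat_adjoint U * U = 1\<^sub>m q" using assms by (auto simp: unitary_mat_def)
  note cU = conj_mat_carrier[OF U]
  show "kron U (conj_mat U) \<in> carrier_mat (q * q) (q * q)" by (rule kron_carrier[OF U cU])
  show "mat_adjoint (kron U (conj_mat U)) * kron U (conj_mat U) = 1\<^sub>m (q * q)"
    unfolding mat_adjoint_kron[OF U cU]
      kron_mult[OF mat_adjoint_carrier[OF U] mat_adjoint_carrier[OF cU] U cU]
    by (simp add: iso conj_mat_isometry[OF U iso] kron_one)
qed

lemma mat_rep_carrier [simp]: "mat_rep e \<in> carrier_mat (ldim e * ldim e) (ldim e * ldim e)"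
  by (simp add: mat_rep_def)

lemma mat_rep_Gate:
  assumes "U \<in> carrier_mat (2 ^ length ks) (2 ^ length ks)"
  shows "mat_rep (Gate ks U) = kron U (conj_mat U)"
  using kron_carrier[OF assms conj_mat_carrier[OF assms]]
  by (simp add: mat_rep_def ldim_def lessThan_Suc mat_sum_singleton)

lemma valid_elementD:
  assumes "valid_element n e"
  shows "length (qubits e) \<in> {1, 2}" "distinct (qubits e)" "set (qubits e) \<subseteq> {..<n}"
    "set (kraus e) \<subseteq> carrier_mat (ldim e) (ldim e)"
  using assms by (cases e; auto simp: ldim_def unitary_mat_def is_channel_def)+

section \<open>Density matrices as vectors of the doubled register\<close>

definition vectorize :: "nat \<Rightarrow> complex mat \<Rightarrow> complex vec" where
  "vectorize r \<rho> = vec (r * r) (\<lambda>i. \<rho> $$ (i div r, i mod r))"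

lemma vectorize_carrier [simp]: "vectorize r \<rho> \<in> carrier_vec (r * r)"
  by (simp add: vectorize_def)

lemma vectorize_index: "i < r * r \<Longrightarrow> vectorize r \<rho> $ i = \<rho> $$ (i div r, i mod r)"
  by (simp add: vectorize_def)

text \<open>With the rows stacked, left multiplication by \<open>A\<close> acts on the high part of
  the index, and right multiplication by \<open>mat_adjoint B\<close> on the low part with
  conjugated coefficients. For \<open>A\<close> and \<open>B\<close> the same Kraus operator this is
  one summand of the matrix representation.\<close>

lemma kron_conj_mat_mult_vectorize:
  assumes A: "A \<in> carrier_mat r r" and B: "B \<in> carrier_mat r r" and \<rho>: "\<rho> \<in> carrier_mat r r"
  shows "kron A (conj_mat B) *\<^sub>v vectorize r \<rho> = vectorize r (A * \<rho> * mat_adjoint B)"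
proof (rule eq_vecI)
  note cB = conj_mat_carrier[OF B]
  note AB = kron_carrier[OF A cB]
  show "dim_vec (kron A (conj_mat B) *\<^sub>v vectorize r \<rho>) = dim_vec (vectorize r (A * \<rho> * mat_adjoint B))"
    using AB by (simp add: vectorize_def)
  fix i assume "i < dim_vec (vectorize r (A * \<rho> * mat_adjoint B))"
  then have i: "i < r * r" by (simp add: vectorize_def)
  have iq: "i div r < r" "i mod r < r" using div_mod_less[OF i] .
  have "(kron A (conj_mat B) *\<^sub>v vectorize r \<rho>) $ i
      = (\<Sum>k<r * r. A $$ (i div r, k div r) * cnj (B $$ (i mod r, k mod r)) * \<rho> $$ (k div r, k mod r))"
    unfolding mult_mat_vec_index[OF AB vectorize_carrier i]
    by (intro sum.cong refl)
      (simp add: kron_index[OF A cB i] conj_mat_index[OF B] vectorize_index iq div_mod_less)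
  also have "\<dots> = (\<Sum>k<r. \<Sum>l<r. A $$ (i div r, k) * cnj (B $$ (i mod r, l)) * \<rho> $$ (k, l))"
    by (rule sum_div_mod[of "\<lambda>k l. A $$ (i div r, k) * cnj (B $$ (i mod r, l)) * \<rho> $$ (k, l)"])
  also have "\<dots> = (\<Sum>l<r. \<Sum>k<r. A $$ (i div r, k) * cnj (B $$ (i mod r, l)) * \<rho> $$ (k, l))"
    by (rule sum.swap)
  also have "\<dots> = (\<Sum>l<r. (\<Sum>k<r. A $$ (i div r, k) * \<rho> $$ (k, l)) * cnj (B $$ (i mod r, l)))"
    by (simp add: sum_distrib_left sum_distrib_right mult_ac)
  also have "\<dots> = (\<Sum>l<r. (A * \<rho>) $$ (i div r, l) * mat_adjoint B $$ (l, i mod r))"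
    by (intro sum.cong refl)
      (simp add: mult_mat_index[OF A \<rho>] mat_adjoint_index[OF B] iq del: index_mult_mat)
  also have "\<dots> = vectorize r (A * \<rho> * mat_adjoint B) $ i"
    unfolding vectorize_index[OF i]
    by (rule mult_mat_index[OF mult_carrier_mat[OF A \<rho>] mat_adjoint_carrier[OF B] iq, symmetric])
  finally show "(kron A (conj_mat B) *\<^sub>v vectorize r \<rho>) $ i = vectorize r (A * \<rho> * mat_adjoint B) $ i" .
qed

lemma mat_sum_mult_vec_index:
  assumes "\<And>z. z \<in> I \<Longrightarrow> F z \<in> carrier_mat q q" "x \<in> carrier_vec q" "i < q"
  shows "(mat_sum q F I *\<^sub>v x) $ i = (\<Sum>z\<in>I. (F z *\<^sub>v x) $ i)"
proof -
  have "(mat_sum q F I *\<^sub>v x) $ i = (\<Sum>k<q. \<Sum>z\<in>I. F z $$ (i, k) * x $ k)"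
    unfolding mult_mat_vec_index[OF mat_sum_carrier assms(2,3)]
    using assms(3) by (simp add: mat_sum_index sum_distrib_right)
  also have "\<dots> = (\<Sum>z\<in>I. \<Sum>k<q. F z $$ (i, k) * x $ k)" by (rule sum.swap)
  also have "\<dots> = (\<Sum>z\<in>I. (F z *\<^sub>v x) $ i)"
    by (intro sum.cong refl) (rule mult_mat_vec_index[OF assms(1) assms(2,3), symmetric])
  finally show ?thesis .
qed

lemma power_double: "(2::nat) ^ (2 * n) = 2 ^ n * 2 ^ n"
  by (simp add: mult_2 power_add)

lemma extend_conj_mat:
  assumes "A \<in> carrier_mat (2 ^ length ks) (2 ^ length ks)"
  shows "extend n ks (conj_mat A) = conj_mat (extend n ks A)"
proof (rule eq_matI)
  fix x y assume "x < dim_row (conj_mat (extend n ks A))" "y < dim_col (conj_mat (extend n ks A))"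
  then have "x < 2 ^ n" "y < 2 ^ n" by (auto simp: conj_mat_def extend_def)
  then show "extend n ks (conj_mat A) $$ (x, y) = conj_mat (extend n ks A) $$ (x, y)"
    by (simp add: extend_index conj_mat_index[OF extend_carrier] conj_mat_index[OF assms] local_index_less)
qed (auto simp: conj_mat_def extend_def)

definition lifted :: "nat \<Rightarrow> element \<Rightarrow> complex mat" where
  "lifted n e = extend (2 * n) (doubled n (qubits e)) (mat_rep e)"

lemma lifted_carrier [simp]: "lifted n e \<in> carrier_mat (2 ^ (2 * n)) (2 ^ (2 * n))"
  unfolding lifted_def by (rule extend_carrier)

lemma length_doubled: "length (doubled n ks) = 2 * length ks"
  by (simp add: doubled_def)

text \<open>A channel acts through Kraus operators extended to n qubits, whereas its matrix
  representation is built locally and extended afterwards. The two agree because extension is linear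
  and compatible with Kronecker products and conjugation.\<close>

lemma lifted_eq_mat_sum:
  assumes "valid_element n e"
  shows "lifted n e = mat_sum (2 ^ (2 * n))
    (\<lambda>k. kron (extend n (qubits e) (kraus e ! k)) (conj_mat (extend n (qubits e) (kraus e ! k)))) {..<length (kraus e)}"
proof -
  let ?ks = "qubits e"
  have K: "kraus e ! k \<in> carrier_mat (2 ^ length ?ks) (2 ^ length ?ks)" if "k < length (kraus e)" for k
    using valid_elementD(4)[OF assms] that by (auto simp: ldim_def)
  have "lifted n e = mat_sum (2 ^ (2 * n))
      (\<lambda>k. extend (2 * n) (doubled n ?ks) (kron (kraus e ! k) (conj_mat (kraus e ! k)))) {..<length (kraus e)}"
    unfolding lifted_def mat_rep_def
    by (rule extend_mat_sum) (simp add: ldim_def length_doubled power_double)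
  also have "\<dots> = mat_sum (2 ^ (2 * n))
      (\<lambda>k. kron (extend n ?ks (kraus e ! k)) (conj_mat (extend n ?ks (kraus e ! k)))) {..<length (kraus e)}"
  proof (rule mat_sum_cong)
    fix k assume "k \<in> {..<length (kraus e)}"
    then have "k < length (kraus e)" by simp
    note K = K[OF this]
    show "extend (2 * n) (doubled n ?ks) (kron (kraus e ! k) (conj_mat (kraus e ! k)))
        = kron (extend n ?ks (kraus e ! k)) (conj_mat (extend n ?ks (kraus e ! k)))"
      unfolding extend_conj_mat[OF K, symmetric]
      by (rule extend_doubled_kron[OF valid_elementD(3)[OF assms] refl K conj_mat_carrier[OF K]])
  qed
  finally show ?thesis .
qed

lemma apply_element_carrier: "apply_element n e \<rho> \<in> carrier_mat (2 ^ n) (2 ^ n)"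
  by (simp add: apply_element_def)

lemma vectorize_apply_element:
  assumes e: "valid_element n e" and \<rho>: "\<rho> \<in> carrier_mat (2 ^ n) (2 ^ n)"
  shows "vectorize (2 ^ n) (apply_element n e \<rho>) = lifted n e *\<^sub>v vectorize (2 ^ n) \<rho>"
proof (rule eq_vecI)
  let ?r = "2 ^ n :: nat" and ?K = "\<lambda>k. extend n (qubits e) (kraus e ! k)"
  have c: "kron (?K k) (conj_mat (?K k)) \<in> carrier_mat (?r * ?r) (?r * ?r)" for k
    by (intro kron_carrier conj_mat_carrier extend_carrier)
  have l: "lifted n e \<in> carrier_mat (?r * ?r) (?r * ?r)" using lifted_carrier[of n e] by (simp only: power_double)
  then show "dim_vec (vectorize ?r (apply_element n e \<rho>)) = dim_vec (lifted n e *\<^sub>v vectorize ?r \<rho>)"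
    by (simp add: vectorize_def)
  fix i assume "i < dim_vec (lifted n e *\<^sub>v vectorize ?r \<rho>)"
  then have i: "i < ?r * ?r" using l by simp
  have "(lifted n e *\<^sub>v vectorize ?r \<rho>) $ i
      = (\<Sum>k<length (kraus e). (kron (?K k) (conj_mat (?K k)) *\<^sub>v vectorize ?r \<rho>) $ i)"
    unfolding lifted_eq_mat_sum[OF e] power_double by (rule mat_sum_mult_vec_index[OF c vectorize_carrier i])
  also have "\<dots> = (\<Sum>k<length (kraus e). (?K k * \<rho> * mat_adjoint (?K k)) $$ (i div ?r, i mod ?r))"
    unfolding kron_conj_mat_mult_vectorize[OF extend_carrier extend_carrier \<rho>] vectorize_index[OF i] ..
  also have "\<dots> = vectorize ?r (apply_element n e \<rho>) $ i"
    unfolding vectorize_index[OF i] apply_element_def mat_sum_index[OF div_mod_less[OF i]] ..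
  finally show "vectorize ?r (apply_element n e \<rho>) $ i = (lifted n e *\<^sub>v vectorize ?r \<rho>) $ i" by simp
qed

definition circuit_mat :: "nat \<Rightarrow> element list \<Rightarrow> complex mat" where
  "circuit_mat n circ = ordered_prod (2 ^ (2 * n)) (map (lifted n) circ)"

lemma circuit_mat_carrier [simp]: "circuit_mat n circ \<in> carrier_mat (2 ^ (2 * n)) (2 ^ (2 * n))"
  unfolding circuit_mat_def by (rule ordered_prod_carrier) auto

text \<open>The carrier claim is part of the induction, since \<open>vectorize_apply_element\<close>
  requires it of the intermediate state.\<close>

lemma vectorize_apply_circuit:
  assumes "noisy_circuit n circ" "\<rho> \<in> carrier_mat (2 ^ n) (2 ^ n)"
  shows "apply_circuit n circ \<rho> \<in> carrier_mat (2 ^ n) (2 ^ n)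
    \<and> vectorize (2 ^ n) (apply_circuit n circ \<rho>) = circuit_mat n circ *\<^sub>v vectorize (2 ^ n) \<rho>"
  using assms(1)
proof (induction circ rule: rev_induct)
  case Nil
  have "vectorize (2 ^ n) \<rho> \<in> carrier_vec (2 ^ (2 * n))" unfolding power_double by simp
  then show ?case using assms(2) by (simp add: apply_circuit_def circuit_mat_def ordered_prod_Nil)
next
  case (snoc e circ)
  then have e: "valid_element n e" and circ: "noisy_circuit n circ" by (auto simp: noisy_circuit_def)
  have v: "vectorize (2 ^ n) \<rho> \<in> carrier_vec (2 ^ (2 * n))" unfolding power_double by simp
  have "vectorize (2 ^ n) (apply_circuit n (circ @ [e]) \<rho>)
      = lifted n e *\<^sub>v (circuit_mat n circ *\<^sub>v vectorize (2 ^ n) \<rho>)"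
    using snoc.IH[OF circ] vectorize_apply_element[OF e] by (simp add: apply_circuit_def)
  also have "\<dots> = (lifted n e * circuit_mat n circ) *\<^sub>v vectorize (2 ^ n) \<rho>"
    by (rule assoc_mult_mat_vec[OF lifted_carrier circuit_mat_carrier v, symmetric])
  finally show ?case
    by (simp add: apply_circuit_def apply_element_carrier circuit_mat_def ordered_prod_snoc)
qed

section \<open>Amplitudes of the doubled circuit\<close>

text \<open>Exact and approximate value are both this functional of a matrix on the doubled
  register. It is linear in \<open>M\<close>, so expansions of matrices become sums of
  numbers.\<close>

definition amplitude :: "complex vec \<Rightarrow> complex vec \<Rightarrow> complex mat \<Rightarrow> complex" where
  "amplitude \<psi> v M = (M *\<^sub>v kron_vec \<psi> (conjugate \<psi>)) \<bullet>c kron_vec v (conjugate v)"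

lemma l2_norm_kron_vec:
  assumes "x \<in> carrier_vec a" "y \<in> carrier_vec b"
  shows "l2_norm (kron_vec x y) = l2_norm x * l2_norm y"
proof -
  have "(\<Sum>i<a * b. (cmod (kron_vec x y $ i))\<^sup>2)
      = (\<Sum>i<a * b. (cmod (x $ (i div b)))\<^sup>2 * (cmod (y $ (i mod b)))\<^sup>2)"
    by (intro sum.cong refl) (simp add: kron_vec_index[OF assms] norm_mult power_mult_distrib)
  also have "\<dots> = (\<Sum>i<a. (cmod (x $ i))\<^sup>2) * (\<Sum>j<b. (cmod (y $ j))\<^sup>2)"
    by (rule sum_product_div_mod[symmetric])
  finally show ?thesis using assms kron_vec_carrier[OF assms] by (simp add: l2_norm_def real_sqrt_mult)
qed

lemma l2_norm_conjugate: "l2_norm (conjugate x) = l2_norm x"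
  by (simp add: l2_norm_def)

text \<open>Cauchy-Schwarz; the doubled input and output states are again unit vectors.\<close>

lemma cmod_amplitude_le:
  assumes \<psi>: "\<psi> \<in> carrier_vec r" "l2_norm \<psi> = 1" and v: "v \<in> carrier_vec r" "l2_norm v = 1"
    and M: "M \<in> carrier_mat (r * r) (r * r)" "op_bound M c"
  shows "cmod (amplitude \<psi> v M) \<le> c"
proof -
  have c\<psi>: "conjugate \<psi> \<in> carrier_vec r" and cv: "conjugate v \<in> carrier_vec r" using \<psi> v by auto
  note K\<psi> = kron_vec_carrier[OF \<psi>(1) c\<psi>] and Kv = kron_vec_carrier[OF v(1) cv]
  have "cmod (amplitude \<psi> v M) \<le> l2_norm (M *\<^sub>v kron_vec \<psi> (conjugate \<psi>)) * l2_norm (kron_vec v (conjugate v))"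
    unfolding amplitude_def by (rule cmod_cscalar_prod_le[OF mult_mat_vec_carrier[OF M(1) K\<psi>] Kv])
  also have "\<dots> \<le> c"
    using op_boundD[OF M(2,1) K\<psi>] \<psi>(2) v(2)
    by (simp add: l2_norm_kron_vec[OF \<psi>(1) c\<psi>] l2_norm_kron_vec[OF v(1) cv] l2_norm_conjugate)
  finally show ?thesis .
qed

lemma amplitude_mat_sum:
  assumes \<psi>: "\<psi> \<in> carrier_vec r" and v: "v \<in> carrier_vec r"
    and F: "\<And>z. z \<in> I \<Longrightarrow> F z \<in> carrier_mat (r * r) (r * r)"
  shows "amplitude \<psi> v (mat_sum (r * r) F I) = (\<Sum>z\<in>I. amplitude \<psi> v (F z))"
proof -
  have c\<psi>: "conjugate \<psi> \<in> carrier_vec r" and cv: "conjugate v \<in> carrier_vec r" using \<psi> v by auto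
  note K\<psi> = kron_vec_carrier[OF \<psi>(1) c\<psi>] and Kv = kron_vec_carrier[OF v(1) cv]
  have "amplitude \<psi> v (mat_sum (r * r) F I)
      = (\<Sum>i<r * r. \<Sum>z\<in>I. (F z *\<^sub>v kron_vec \<psi> (conjugate \<psi>)) $ i * cnj (kron_vec v (conjugate v) $ i))"
    unfolding amplitude_def cscalar_prod_eq_sum[OF Kv]
    by (intro sum.cong refl) (simp add: mat_sum_mult_vec_index[OF F K\<psi>] sum_distrib_right del: index_mult_mat_vec)
  also have "\<dots> = (\<Sum>z\<in>I. amplitude \<psi> v (F z))"
    unfolding amplitude_def cscalar_prod_eq_sum[OF Kv] by (rule sum.swap)
  finally show ?thesis .
qed

lemma amplitude_kron:
  assumes \<psi>: "\<psi> \<in> carrier_vec r" and v: "v \<in> carrier_vec r"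
    and A: "A \<in> carrier_mat r r" and B: "B \<in> carrier_mat r r"
  shows "amplitude \<psi> v (kron A B) = ((A *\<^sub>v \<psi>) \<bullet>c v) * ((B *\<^sub>v conjugate \<psi>) \<bullet>c conjugate v)"
proof -
  have c\<psi>: "conjugate \<psi> \<in> carrier_vec r" and cv: "conjugate v \<in> carrier_vec r" using \<psi> v by auto
  show ?thesis
    unfolding amplitude_def kron_mult_kron_vec[OF A B \<psi> c\<psi>]
    by (rule kron_vec_cscalar_prod[OF mult_mat_vec_carrier[OF A \<psi>] mult_mat_vec_carrier[OF B c\<psi>] v cv])
qed

text \<open>The pure input state vectorises to \<open>kron_vec \<psi> (conjugate \<psi>)\<close>,
  and the expectation of a state in \<open>v\<close> is the inner product of its vectorisation with
  \<open>kron_vec v (conjugate v)\<close>.\<close>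

lemma exact_value_eq_amplitude:
  assumes circ: "noisy_circuit n circ" and \<psi>: "\<psi> \<in> carrier_vec (2 ^ n)" and v: "v \<in> carrier_vec (2 ^ n)"
  shows "exact_value n circ \<psi> v = amplitude \<psi> v (circuit_mat n circ)"
proof -
  let ?r = "2 ^ n :: nat"
  have c\<psi>: "conjugate \<psi> \<in> carrier_vec ?r" and cv: "conjugate v \<in> carrier_vec ?r" using \<psi> v by auto
  have "vectorize ?r (ket_bra \<psi>) = kron_vec \<psi> (conjugate \<psi>)"
    using \<psi> c\<psi> by (intro eq_vecI)
      (auto simp: vectorize_index kron_vec_index[OF \<psi> c\<psi>] ket_bra_def div_mod_less vectorize_def kron_vec_def)
  moreover have "ket_bra \<psi> \<in> carrier_mat ?r ?r" using \<psi> by (auto simp: ket_bra_def)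
  ultimately obtain \<rho> where \<rho>: "\<rho> = apply_circuit n circ (ket_bra \<psi>)" "\<rho> \<in> carrier_mat ?r ?r"
    "vectorize ?r \<rho> = circuit_mat n circ *\<^sub>v kron_vec \<psi> (conjugate \<psi>)"
    using vectorize_apply_circuit[OF circ] by metis
  have "exact_value n circ \<psi> v = (\<Sum>i<?r. \<Sum>j<?r. \<rho> $$ (i, j) * v $ j * cnj (v $ i))"
    unfolding exact_value_def \<rho>(1)[symmetric] cscalar_prod_eq_sum[OF v]
    by (intro sum.cong refl) (simp add: mult_mat_vec_index[OF \<rho>(2) v] sum_distrib_right del: index_mult_mat_vec)
  also have "\<dots> = (\<Sum>k<?r * ?r. \<rho> $$ (k div ?r, k mod ?r) * v $ (k mod ?r) * cnj (v $ (k div ?r)))"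
    by (rule sum_div_mod[of "\<lambda>i j. \<rho> $$ (i, j) * v $ j * cnj (v $ i)", symmetric])
  also have "\<dots> = vectorize ?r \<rho> \<bullet>c kron_vec v (conjugate v)"
    unfolding cscalar_prod_eq_sum[OF kron_vec_carrier[OF v cv]]
    using v by (intro sum.cong refl) (simp add: vectorize_index kron_vec_index[OF v cv] div_mod_less mult_ac)
  finally show ?thesis by (simp add: amplitude_def \<rho>(3))
qed

section \<open>Expansion into dominant and residual terms\<close>

definition path :: "nat \<Rightarrow> element list \<Rightarrow> (nat \<Rightarrow> svd) \<Rightarrow> nat set \<Rightarrow> complex mat" where
  "path n circ w P = ordered_prod (2 ^ (2 * n)) (map (factor n circ w P) [0..<length circ])"

lemma factor_carrier [simp]: "factor n circ w P s \<in> carrier_mat (2 ^ (2 * n)) (2 ^ (2 * n))"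
  unfolding factor_def by (rule extend_carrier)

lemma path_carrier [simp]: "path n circ w P \<in> carrier_mat (2 ^ (2 * n)) (2 ^ (2 * n))"
  unfolding path_def by (rule ordered_prod_carrier) auto

lemma finite_noises [simp]: "finite (noises circ)"
  by (simp add: noises_def)

lemma svd_choiceD:
  assumes "svd_choice circ w" "s \<in> noises circ"
  shows "is_svd (ldim (circ ! s) * ldim (circ ! s)) (tensor_perm (ldim (circ ! s)) (mat_rep (circ ! s))) (w s)"
  using assms by (auto simp: svd_choice_def Let_def)

lemma ldim_pos: "0 < ldim e"
  by (simp add: ldim_def)

text \<open>Every noise is a sum of two terms and every gate of one, so the choice functions of
  \<open>ordered_prod_mat_sum\<close> correspond to the sets of noises at which the residual is
  chosen.\<close>

lemma circuit_mat_eq_sum_path: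
  assumes svd: "svd_choice circ w"
  shows "circuit_mat n circ = mat_sum (2 ^ (2 * n)) (path n circ w) (Pow (noises circ))"
proof -
  let ?D = "2 ^ (2 * n) :: nat" and ?L = "length circ"
  define G where "G s b = (if is_Noise (circ ! s)
    then if b then residual (ldim (circ ! s)) (w s) else dominant (ldim (circ ! s)) (w s)
    else mat_rep (circ ! s))" for s b
  define F where "F s b = extend (2 * n) (doubled n (qubits (circ ! s))) (G s b)" for s b
  \<comment> \<open>A gate gets the single choice \<open>False\<close>, so a choice function carries
    information only at the noises.\<close>
  define X where "X s = (if s \<in> noises circ then UNIV else {False})" for s
  \<comment> \<open>The indicator of \<open>P\<close>, made \<open>undefined\<close> off the
    positions of the circuit so that it lies in the extensional product.\<close>
  define h where "h P = restrict (\<lambda>s. s \<in> P) {..<?L}" for P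
  have factor: "factor n circ w P s = F s (s \<in> P)" for P s
    by (simp add: factor_def F_def G_def)
  have lifted: "lifted n (circ ! s) = mat_sum ?D (F s) (X s)" if s: "s < ?L" for s
  proof -
    let ?q = "ldim (circ ! s)"
    have "mat_rep (circ ! s) = mat_sum (?q * ?q) (G s) (X s)"
    proof (cases "s \<in> noises circ")
      case True
      then have G: "G s True = residual ?q (w s)" "G s False = dominant ?q (w s)"
        by (auto simp: G_def noises_def)
      have c: "dominant ?q (w s) \<in> carrier_mat (?q * ?q) (?q * ?q)"
        "residual ?q (w s) \<in> carrier_mat (?q * ?q) (?q * ?q)"
        by (simp_all add: dominant_def svd_term_carrier residual_def)
      have "mat_rep (circ ! s) = dominant ?q (w s) + residual ?q (w s)"
        by (rule mat_eq_dominant_plus_residual[OF mat_rep_carrier svd_choiceD[OF svd True] ldim_pos])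
      also have "\<dots> = mat_sum (?q * ?q) (G s) (X s)"
      proof (rule eq_matI)
        fix i j assume "i < dim_row (mat_sum (?q * ?q) (G s) (X s))" "j < dim_col (mat_sum (?q * ?q) (G s) (X s))"
        then have "i < ?q * ?q" "j < ?q * ?q" by (auto simp: mat_sum_def)
        then show "(dominant ?q (w s) + residual ?q (w s)) $$ (i, j) = mat_sum (?q * ?q) (G s) (X s) $$ (i, j)"
          using True c by (simp add: mat_sum_index X_def UNIV_bool G add.commute)
      qed (use c in \<open>auto simp: mat_sum_def\<close>)
      finally show ?thesis .
    next
      case False
      then have "G s False = mat_rep (circ ! s)" using s by (auto simp: G_def noises_def)
      then show ?thesis using False by (simp add: X_def mat_sum_singleton)
    qed
    then show ?thesis
      unfolding lifted_def F_def
      by (simp only:) (rule extend_mat_sum, simp add: ldim_def length_doubled power_double)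
  qed
  have bij: "bij_betw h (Pow (noises circ)) (\<Pi>\<^sub>E s\<in>{..<?L}. X s)"
  proof (rule bij_betw_byWitness[where f' = "\<lambda>f. {s. s < ?L \<and> f s}"]; intro ballI image_subsetI)
    fix P assume "P \<in> Pow (noises circ)"
    then have P: "P \<subseteq> noises circ" by simp
    then show "{s. s < ?L \<and> h P s} = P" by (auto simp: h_def noises_def)
    show "h P \<in> (\<Pi>\<^sub>E s\<in>{..<?L}. X s)" using P by (intro PiE_I) (auto simp: h_def X_def)
  next
    fix f assume f: "f \<in> (\<Pi>\<^sub>E s\<in>{..<?L}. X s)"
    show "h {s. s < ?L \<and> f s} = f"
    proof
      fix s
      show "h {s. s < ?L \<and> f s} s = f s"
        using PiE_arb[OF f, of s] by (cases "s < ?L") (simp_all add: h_def)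
    qed
    have "s \<in> noises circ" if "s < ?L" "f s" for s
      using PiE_mem[OF f, of s] that by (cases "s \<in> noises circ") (simp_all add: X_def)
    then show "{s. s < ?L \<and> f s} \<in> Pow (noises circ)" by blast
  qed
  have "map (lifted n) circ = map (\<lambda>s. lifted n (circ ! s)) [0..<?L]"
    by (intro nth_equalityI) simp_all
  also have "\<dots> = map (\<lambda>s. mat_sum ?D (F s) (X s)) [0..<?L]" using lifted by simp
  finally have "circuit_mat n circ
      = mat_sum ?D (\<lambda>f. ordered_prod ?D (map (\<lambda>s. F s (f s)) [0..<?L])) (\<Pi>\<^sub>E s\<in>{..<?L}. X s)"
    unfolding circuit_mat_def by (simp only:) (rule ordered_prod_mat_sum, auto simp: X_def F_def)
  also have "\<dots> = mat_sum ?D (\<lambda>P. ordered_prod ?D (map (\<lambda>s. F s (h P s)) [0..<?L])) (Pow (noises circ))"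
    by (rule mat_sum_reindex[OF bij])
  also have "\<dots> = mat_sum ?D (path n circ w) (Pow (noises circ))"
  proof (rule mat_sum_cong)
    fix P
    have "map (\<lambda>s. F s (h P s)) [0..<?L] = map (factor n circ w P) [0..<?L]"
      by (simp add: h_def factor)
    then show "ordered_prod ?D (map (\<lambda>s. F s (h P s)) [0..<?L]) = path n circ w P"
      by (simp only: path_def)
  qed
  finally show ?thesis .
qed

text \<open>Expanding the residuals at \<open>P\<close> into their singular terms makes every factor
  a sum of Kronecker products. Each choice of terms separates over the two copies, and its amplitude
  is a product of two contractions.\<close>

lemma amplitude_path_eq_sum_contract:
  assumes circ: "noisy_circuit n circ" and P: "P \<subseteq> noises circ"
    and \<psi>: "\<psi> \<in> carrier_vec (2 ^ n)" and v: "v \<in> carrier_vec (2 ^ n)"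
  shows "amplitude \<psi> v (path n circ w P)
    = (\<Sum>j\<in>(\<Pi>\<^sub>E s\<in>P. {1..(ldim (circ ! s))\<^sup>2 - 1}). prod_list (map (contract n) (networks circ w \<psi> v (P, j))))"
proof -
  let ?r = "2 ^ n :: nat" and ?L = "length circ"
  define a where "a s k = (case circ ! s of Gate ks U \<Rightarrow> U | Noise ks Es \<Rightarrow> svd_U (2 ^ length ks) (w s) k)" for s k
  define b where "b s k = (case circ ! s of Gate ks U \<Rightarrow> conj_mat U
    | Noise ks Es \<Rightarrow> svd_V (2 ^ length ks) (w s) k)" for s k
  define A where "A s k = extend n (qubits (circ ! s)) (a s k)" for s k
  define B where "B s k = extend n (qubits (circ ! s)) (b s k)" for s k
  define Z where "Z s = {1..(ldim (circ ! s))\<^sup>2 - 1}" for s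
  \<comment> \<open>Off \<open>P\<close> the only choice is 0: it selects the dominant term of a
    noise, while at a gate \<open>a\<close> and \<open>b\<close> ignore it.\<close>
  define Y where "Y s = (if s \<in> P then Z s else {0})" for s
  define h where "h j = restrict (\<lambda>s. if s \<in> P then j s else 0) {..<?L}" for j :: "nat \<Rightarrow> nat"
  \<comment> \<open>Reconciles the index range of \<open>runs\<close>, written with a subtraction,
    with the half-open one of \<open>residual\<close>.\<close>
  have Z: "Z s = {1..<ldim (circ ! s) * ldim (circ ! s)}" for s
    unfolding Z_def using ldim_pos[of "circ ! s"] by (auto simp: power2_eq_square)
  have P_lt: "s < ?L" if "s \<in> P" for s using P that by (auto simp: noises_def)
  have valid: "valid_element n (circ ! s)" if "s < ?L" for s
    using circ that by (simp add: noisy_circuit_def)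
  have svd_car: "svd_U q u k \<in> carrier_mat q q" "svd_V q u k \<in> carrier_mat q q" for q u k
    by (cases u; simp)+
  have car: "a s k \<in> carrier_mat (2 ^ length (qubits (circ ! s))) (2 ^ length (qubits (circ ! s)))"
    "b s k \<in> carrier_mat (2 ^ length (qubits (circ ! s))) (2 ^ length (qubits (circ ! s)))" if "s < ?L" for s k
    using valid[OF that] by (cases "circ ! s"; simp add: a_def b_def svd_car conj_mat_carrier unitary_mat_def)+
  have factor: "factor n circ w P s = mat_sum (?r * ?r) (\<lambda>k. kron (A s k) (B s k)) (Y s)" if s: "s < ?L" for s
  proof -
    let ?q = "ldim (circ ! s)" and ?ks = "qubits (circ ! s)"
    have c: "kron (a s k) (b s k) \<in> carrier_mat (?q * ?q) (?q * ?q)" for k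
      unfolding ldim_def by (rule kron_carrier[OF car[OF s]])
    have "(if is_Noise (circ ! s) then if s \<in> P then residual ?q (w s) else dominant ?q (w s)
        else mat_rep (circ ! s)) = mat_sum (?q * ?q) (\<lambda>k. kron (a s k) (b s k)) (Y s)"
    proof (cases "circ ! s")
      case (Gate ks U)
      then have "s \<notin> P" "U \<in> carrier_mat (2 ^ length ks) (2 ^ length ks)"
        using P valid[OF s] by (auto simp: noises_def unitary_mat_def)
      then show ?thesis using Gate c by (simp add: Y_def mat_sum_singleton mat_rep_Gate a_def b_def)
    next
      case (Noise ks Es)
      then show ?thesis
        using c[of 0] unfolding Y_def Z
        by (simp add: mat_sum_singleton a_def b_def residual_def dominant_def ldim_def)
    qed
    then have "factor n circ w P s
        = extend (2 * n) (doubled n ?ks) (mat_sum (?q * ?q) (\<lambda>k. kron (a s k) (b s k)) (Y s))"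
      unfolding factor_def by (simp only:)
    also have "\<dots> = mat_sum (2 ^ (2 * n)) (\<lambda>k. extend (2 * n) (doubled n ?ks) (kron (a s k) (b s k))) (Y s)"
      by (rule extend_mat_sum) (simp add: ldim_def length_doubled power_double)
    also have "\<dots> = mat_sum (?r * ?r) (\<lambda>k. kron (A s k) (B s k)) (Y s)"
      unfolding power_double A_def B_def
      by (intro mat_sum_cong extend_doubled_kron[OF valid_elementD(3)[OF valid[OF s]] refl car[OF s]])
    finally show ?thesis .
  qed
  \<comment> \<open>The values of a choice off \<open>P\<close> are forced, so restricting it to
    \<open>P\<close> loses nothing.\<close>
  have bij: "bij_betw h (\<Pi>\<^sub>E s\<in>P. Z s) (\<Pi>\<^sub>E s\<in>{..<?L}. Y s)"
  proof (rule bij_betw_byWitness[where f' = "\<lambda>f. restrict f P"]; intro ballI image_subsetI)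
    fix j assume j: "j \<in> (\<Pi>\<^sub>E s\<in>P. Z s)"
    show "restrict (h j) P = j"
    proof
      fix s
      show "restrict (h j) P s = j s"
        using PiE_arb[OF j, of s] P_lt[of s] by (cases "s \<in> P") (simp_all add: h_def)
    qed
    show "h j \<in> (\<Pi>\<^sub>E s\<in>{..<?L}. Y s)"
      using PiE_mem[OF j] by (intro PiE_I) (simp_all add: h_def Y_def)
  next
    fix f assume f: "f \<in> (\<Pi>\<^sub>E s\<in>{..<?L}. Y s)"
    have Y: "f s \<in> Y s" if "s < ?L" for s using PiE_mem[OF f] that by simp
    show "h (restrict f P) = f"
    proof
      fix s
      show "h (restrict f P) s = f s"
        using PiE_arb[OF f, of s] Y[of s] by (cases "s < ?L") (simp_all add: h_def Y_def split: if_splits)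
    qed
    show "restrict f P \<in> (\<Pi>\<^sub>E s\<in>P. Z s)"
    proof (rule PiE_I)
      fix s assume "s \<in> P"
      then show "restrict f P s \<in> Z s" using Y[OF P_lt] by (simp add: Y_def)
    qed simp
  qed
  have AB: "A s k \<in> carrier_mat ?r ?r" "B s k \<in> carrier_mat ?r ?r" for s k by (simp_all add: A_def B_def)
  let ?A = "\<lambda>j. ordered_prod ?r (map (\<lambda>s. A s (if s \<in> P then j s else 0)) [0..<?L])"
  let ?B = "\<lambda>j. ordered_prod ?r (map (\<lambda>s. B s (if s \<in> P then j s else 0)) [0..<?L])"
  have cAB: "?A j \<in> carrier_mat ?r ?r" "?B j \<in> carrier_mat ?r ?r" for j
    using AB by (auto intro!: ordered_prod_carrier)
  have "map (factor n circ w P) [0..<?L] = map (\<lambda>s. mat_sum (?r * ?r) (\<lambda>k. kron (A s k) (B s k)) (Y s)) [0..<?L]"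
    using factor by simp
  then have "path n circ w P = mat_sum (?r * ?r)
      (\<lambda>f. ordered_prod (?r * ?r) (map (\<lambda>s. kron (A s (f s)) (B s (f s))) [0..<?L])) (\<Pi>\<^sub>E s\<in>{..<?L}. Y s)"
    unfolding path_def power_double
    by (simp only:) (rule ordered_prod_mat_sum, auto simp: Y_def Z_def intro!: kron_carrier AB)
  also have "\<dots> = mat_sum (?r * ?r)
      (\<lambda>j. ordered_prod (?r * ?r) (map (\<lambda>s. kron (A s (h j s)) (B s (h j s))) [0..<?L])) (\<Pi>\<^sub>E s\<in>P. Z s)"
    by (rule mat_sum_reindex[OF bij])
  also have "\<dots> = mat_sum (?r * ?r) (\<lambda>j. kron (?A j) (?B j)) (\<Pi>\<^sub>E s\<in>P. Z s)"
  proof (rule mat_sum_cong)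
    fix j
    have "map (\<lambda>s. kron (A s (h j s)) (B s (h j s))) [0..<?L]
        = map (\<lambda>s. kron (A s (if s \<in> P then j s else 0)) (B s (if s \<in> P then j s else 0))) [0..<?L]"
      by (rule map_cong[OF refl]) (auto simp: h_def)
    then show "ordered_prod (?r * ?r) (map (\<lambda>s. kron (A s (h j s)) (B s (h j s))) [0..<?L]) = kron (?A j) (?B j)"
      by (simp only:) (rule ordered_prod_kron, rule AB, rule AB)
  qed
  finally have "amplitude \<psi> v (path n circ w P) = (\<Sum>j\<in>(\<Pi>\<^sub>E s\<in>P. Z s). amplitude \<psi> v (kron (?A j) (?B j)))"
    by (simp only:) (rule amplitude_mat_sum[OF \<psi> v kron_carrier[OF cAB]])
  also have "\<dots> = (\<Sum>j\<in>(\<Pi>\<^sub>E s\<in>P. Z s). prod_list (map (contract n) (networks circ w \<psi> v (P, j))))"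
  proof (rule sum.cong[OF refl])
    fix j
    have "first_tensor circ w P j s = (qubits (circ ! s), a s (if s \<in> P then j s else 0))"
      "second_tensor circ w P j s = (qubits (circ ! s), b s (if s \<in> P then j s else 0))" for s
      by (cases "circ ! s"; simp add: first_tensor_def second_tensor_def a_def b_def)+
    then have "map (\<lambda>(ks, A). extend n ks A) (map (first_tensor circ w P j) [0..<?L])
        = map (\<lambda>s. A s (if s \<in> P then j s else 0)) [0..<?L]"
      "map (\<lambda>(ks, A). extend n ks A) (map (second_tensor circ w P j) [0..<?L])
        = map (\<lambda>s. B s (if s \<in> P then j s else 0)) [0..<?L]"
      by (simp_all add: A_def B_def)
    then show "amplitude \<psi> v (kron (?A j) (?B j)) = prod_list (map (contract n) (networks circ w \<psi> v (P, j)))"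
      unfolding amplitude_kron[OF \<psi> v cAB] networks.simps list.map prod_list.Cons prod_list.Nil contract.simps
      by (simp only: mult_1_right)
  qed
  finally show ?thesis by (simp only: Z_def)
qed

text \<open>Passes between sums over levels and sums over sets, for the approximation, for its error
  and for the number of runs.\<close>

lemma sum_subsets_by_card:
  fixes f :: "'a set \<Rightarrow> 'b::comm_monoid_add"
  assumes "finite A" "finite U"
  shows "(\<Sum>u\<in>U. \<Sum>P | P \<subseteq> A \<and> card P = u. f P) = (\<Sum>P | P \<subseteq> A \<and> card P \<in> U. f P)"
proof -
  have "(\<Sum>u\<in>U. \<Sum>P | P \<subseteq> A \<and> card P = u. f P)
      = (\<Sum>u\<in>U. \<Sum>P\<in>{P \<in> {P. P \<subseteq> A \<and> card P \<in> U}. card P = u}. f P)"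
    by (intro sum.cong refl) auto
  also have "\<dots> = (\<Sum>P | P \<subseteq> A \<and> card P \<in> U. f P)"
    using assms by (intro sum.group) auto
  finally show ?thesis .
qed

text \<open>Together with \<open>approx_value_eq_sum_path\<close> this exhibits the error as the sum
  over the sets of more than \<open>l\<close> noises.\<close>

lemma exact_value_eq_sum_path:
  assumes "noisy_circuit n circ" "svd_choice circ w" and \<psi>: "\<psi> \<in> carrier_vec (2 ^ n)" and v: "v \<in> carrier_vec (2 ^ n)"
  shows "exact_value n circ \<psi> v = (\<Sum>P\<in>Pow (noises circ). amplitude \<psi> v (path n circ w P))"
  unfolding exact_value_eq_amplitude[OF assms(1,3,4)] circuit_mat_eq_sum_path[OF assms(2)] power_double
  by (rule amplitude_mat_sum[OF \<psi> v path_carrier[unfolded power_double]])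

lemma approx_value_eq_sum_path:
  assumes \<psi>: "\<psi> \<in> carrier_vec (2 ^ n)" and v: "v \<in> carrier_vec (2 ^ n)"
  shows "approx_value n circ w l \<psi> v
    = (\<Sum>P | P \<subseteq> noises circ \<and> card P \<le> l. amplitude \<psi> v (path n circ w P))"
proof -
  let ?r = "2 ^ n :: nat"
  have T: "T_term n circ w u = mat_sum (?r * ?r) (path n circ w) {P. P \<subseteq> noises circ \<and> card P = u}" for u
    unfolding T_term_def path_def power_double ..
  have "approx_value n circ w l \<psi> v = amplitude \<psi> v (mat_sum (?r * ?r) (T_term n circ w) {0..l})"
    unfolding approx_value_def amplitude_def level_approx_def power_double ..
  also have "\<dots> = (\<Sum>u\<in>{0..l}. amplitude \<psi> v (T_term n circ w u))"
    by (rule amplitude_mat_sum[OF \<psi> v]) (simp add: T)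
  also have "\<dots> = (\<Sum>u\<in>{0..l}. \<Sum>P | P \<subseteq> noises circ \<and> card P = u. amplitude \<psi> v (path n circ w P))"
    unfolding T by (intro sum.cong refl amplitude_mat_sum[OF \<psi> v path_carrier[unfolded power_double]])
  also have "\<dots> = (\<Sum>P | P \<subseteq> noises circ \<and> card P \<in> {0..l}. amplitude \<psi> v (path n circ w P))"
    by (intro sum_subsets_by_card) auto
  finally show ?thesis by simp
qed

text \<open>Ties the runs that are counted to the value that is estimated: the runs with a fixed
  \<open>P\<close> add up to the amplitude of the path of \<open>P\<close>.\<close>

lemma algorithm_output_eq_approx_value:
  assumes circ: "noisy_circuit n circ" and \<psi>: "\<psi> \<in> carrier_vec (2 ^ n)" and v: "v \<in> carrier_vec (2 ^ n)"
  shows "algorithm_output n circ w l \<psi> v = approx_value n circ w l \<psi> v"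
proof -
  have fin: "finite {P. P \<subseteq> noises circ \<and> card P \<le> l}" by simp
  have fin': "finite (\<Pi>\<^sub>E s\<in>P. {1..(ldim (circ ! s))\<^sup>2 - 1})" if "P \<subseteq> noises circ" for P
    using finite_subset[OF that finite_noises] by (intro finite_PiE) auto
  have "algorithm_output n circ w l \<psi> v = (\<Sum>P | P \<subseteq> noises circ \<and> card P \<le> l.
      \<Sum>j\<in>(\<Pi>\<^sub>E s\<in>P. {1..(ldim (circ ! s))\<^sup>2 - 1}). prod_list (map (contract n) (networks circ w \<psi> v (P, j))))"
    unfolding algorithm_output_def runs_def using fin fin'
    by (subst sum.Sigma) (auto simp del: networks.simps intro!: sum.cong)
  also have "\<dots> = approx_value n circ w l \<psi> v"
    unfolding approx_value_eq_sum_path[OF \<psi> v]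
    by (intro sum.cong refl amplitude_path_eq_sum_contract[OF circ _ \<psi> v, symmetric]) auto
  finally show ?thesis .
qed

section \<open>The error bound\<close>

lemma ldim_le:
  assumes "valid_element n e"
  shows "ldim e \<le> 4"
  using valid_elementD(1)[OF assms] by (auto simp: ldim_def)

lemma op_bound_path:
  assumes circ: "noisy_circuit n circ" and svd: "svd_choice circ w" and P: "P \<subseteq> noises circ"
    and rate: "\<And>s. s \<in> noises circ \<Longrightarrow> noise_rate (circ ! s) \<le> p" and p: "0 \<le> p"
  shows "op_bound (path n circ w P) ((4 * p) ^ card P * (1 + 8 * p) ^ (card (noises circ) - card P))"
proof -
  let ?L = "length circ"
  define c where "c s = (if s \<in> noises circ then if s \<in> P then 4 * p else 1 + 8 * p else 1)" for s
  have c0: "0 \<le> c s" for s using p by (simp add: c_def)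
  have bound: "op_bound (factor n circ w P s) (c s)" if s: "s < ?L" for s
  proof -
    let ?e = "circ ! s" and ?q = "ldim (circ ! s)"
    have e: "valid_element n ?e" using circ s by (simp add: noisy_circuit_def)
    note ks = valid_elementD(2,3)[OF e]
    \<comment> \<open>The two copies occupy disjoint ranges of qubits, since the shifted ones are at
      least \<open>n\<close>.\<close>
    have dks: "distinct (doubled n (qubits ?e))" "set (doubled n (qubits ?e)) \<subseteq> {..<2 * n}"
      using ks by (auto simp: doubled_def distinct_map inj_on_def)
    have q: "?q * ?q = 2 ^ length (doubled n (qubits ?e))" by (simp add: ldim_def length_doubled power_double)
    have "(if is_Noise ?e then if s \<in> P then residual ?q (w s) else dominant ?q (w s) else mat_rep ?e)
        \<in> carrier_mat (?q * ?q) (?q * ?q)"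
      by (simp add: residual_def dominant_def svd_term_carrier)
    moreover have "op_bound (if is_Noise ?e then if s \<in> P then residual ?q (w s) else dominant ?q (w s)
        else mat_rep ?e) (c s)"
    proof (cases "s \<in> noises circ")
      case True
      have "spectral_norm (mat_rep ?e - 1\<^sub>m (?q * ?q)) \<le> p" using rate[OF True] by (simp add: noise_rate_def)
      note rd = op_bound_residual_dominant[OF mat_rep_carrier svd_choiceD[OF svd True] ldim_pos this]
      \<comment> \<open>The local dimension is 2 or 4; single-qubit noises are given the two-qubit
        constant, so that one bound covers both kinds.\<close>
      have qp: "real ?q * p \<le> 4 * p" using ldim_le[OF e] p by (intro mult_right_mono) auto
      have "op_bound (residual ?q (w s)) (4 * p)" by (rule op_bound_mono[OF rd(1) qp])
      moreover have "op_bound (dominant ?q (w s)) (1 + 8 * p)" by (rule op_bound_mono[OF rd(2)]) (use qp in \<open>simp add: mult.commute\<close>)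
      ultimately show ?thesis using True by (simp add: c_def noises_def)
    next
      case False
      then obtain ks U where U: "?e = Gate ks U" using s by (cases ?e) (auto simp: noises_def)
      then have "unitary_mat (2 ^ length ks) U" using e by simp
      then have "op_bound (mat_rep ?e) 1"
        unfolding U by (subst mat_rep_Gate) (auto simp: unitary_mat_def op_bound_kron_conj_mat)
      then show ?thesis using False s by (simp add: c_def noises_def)
    qed
    ultimately show ?thesis
      unfolding factor_def using c0 by (intro op_bound_extend[OF dks]) (simp_all only: q)
  qed
  have "prod_list (map c [0..<?L]) = prod c {..<?L}"
    using prod.distinct_set_conv_list[of "[0..<?L]" c] by (simp add: lessThan_atLeast0)
  \<comment> \<open>Gates contribute 1 and drop out of the product.\<close>
  also have "\<dots> = prod c (noises circ)"
    by (rule prod.mono_neutral_right) (auto simp: noises_def c_def)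
  also have "\<dots> = prod c (noises circ - P) * prod c P"
    by (rule prod.subset_diff[OF P finite_noises])
  also have "prod c P = (4 * p) ^ card P"
    using P by (subst prod.cong[OF refl, of _ _ "\<lambda>_. 4 * p"]) (auto simp: c_def)
  also have "prod c (noises circ - P) = (1 + 8 * p) ^ (card (noises circ) - card P)"
    using card_Diff_subset[OF finite_subset[OF P finite_noises] P]
    by (subst prod.cong[OF refl, of _ _ "\<lambda>_. 1 + 8 * p"]) (auto simp: c_def)
  finally have prod: "prod_list (map c [0..<?L]) = (4 * p) ^ card P * (1 + 8 * p) ^ (card (noises circ) - card P)"
    by (simp add: mult.commute)
  show ?thesis
    unfolding path_def prod[symmetric] by (rule op_bound_ordered_prod) (auto simp: bound c0)
qed

lemma card_noises:
  assumes "noisy_circuit n circ"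
  shows "card (noises circ) = num_noises circ 1 + num_noises circ 2"
proof -
  let ?N = "\<lambda>k. {s \<in> noises circ. length (qubits (circ ! s)) = k}"
  have "length (qubits (circ ! s)) \<in> {1, 2}" if "s \<in> noises circ" for s
    using assms that by (intro valid_elementD(1)[of n]) (simp add: noisy_circuit_def noises_def)
  then have "noises circ = ?N 1 \<union> ?N 2" by auto
  moreover have "card (?N 1 \<union> ?N 2) = card (?N 1) + card (?N 2)" by (rule card_Un_disjoint) auto
  ultimately show ?thesis by (simp add: num_noises_def)
qed

lemma approx_error:
  assumes circ: "noisy_circuit n circ" and svd: "svd_choice circ w"
    and rate: "\<And>s. s \<in> noises circ \<Longrightarrow> noise_rate (circ ! s) < p" and l: "l < card (noises circ)"
    and \<psi>: "\<psi> \<in> carrier_vec (2 ^ n)" "l2_norm \<psi> = 1" and v: "v \<in> carrier_vec (2 ^ n)" "l2_norm v = 1"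
  shows "cmod (exact_value n circ \<psi> v - approx_value n circ w l \<psi> v)
    < (\<Sum>u=l+1..card (noises circ). real (card (noises circ) choose u) * (16 * p) ^ u
        * (1 + 16 * p) ^ (card (noises circ) - u))"
proof -
  let ?N = "card (noises circ)" and ?amp = "\<lambda>P. amplitude \<psi> v (path n circ w P)"
  \<comment> \<open>Since \<open>l\<close> is below the number of noises there is at least one, and
    its nonnegative rate forces \<open>p\<close> to be positive.\<close>
  obtain s where "s \<in> noises circ" using l by fastforce
  then have p: "0 < p" using rate spectral_norm_nonneg by (metis noise_rate_def order_le_less_trans)
  have "exact_value n circ \<psi> v - approx_value n circ w l \<psi> v
      = (\<Sum>P\<in>Pow (noises circ) - {P. P \<subseteq> noises circ \<and> card P \<le> l}. ?amp P)"
    unfolding exact_value_eq_sum_path[OF circ svd \<psi>(1) v(1)] approx_value_eq_sum_path[OF \<psi>(1) v(1)]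
    by (rule sum_diff[symmetric]) auto
  also have "Pow (noises circ) - {P. P \<subseteq> noises circ \<and> card P \<le> l}
      = {P. P \<subseteq> noises circ \<and> card P \<in> {l+1..?N}}"
    by (auto simp: card_mono)
  finally have "cmod (exact_value n circ \<psi> v - approx_value n circ w l \<psi> v)
      \<le> (\<Sum>P | P \<subseteq> noises circ \<and> card P \<in> {l+1..?N}. cmod (?amp P))"
    by (simp only: norm_sum)
  also have "\<dots> \<le> (\<Sum>P | P \<subseteq> noises circ \<and> card P \<in> {l+1..?N}. (4 * p) ^ card P * (1 + 8 * p) ^ (?N - card P))"
  proof (rule sum_mono)
    fix P assume "P \<in> {P. P \<subseteq> noises circ \<and> card P \<in> {l+1..?N}}"
    then have P: "P \<subseteq> noises circ" by simp
    show "cmod (?amp P) \<le> (4 * p) ^ card P * (1 + 8 * p) ^ (?N - card P)"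
      using rate p by (intro cmod_amplitude_le[OF \<psi> v path_carrier[unfolded power_double]]
        op_bound_path[OF circ svd P]) (auto intro: less_imp_le)
  qed
  also have "\<dots> = (\<Sum>u\<in>{l+1..?N}. \<Sum>P | P \<subseteq> noises circ \<and> card P = u. (4 * p) ^ card P * (1 + 8 * p) ^ (?N - card P))"
    by (rule sum_subsets_by_card[symmetric]) auto
  also have "\<dots> = (\<Sum>u=l+1..?N. real (?N choose u) * (4 * p) ^ u * (1 + 8 * p) ^ (?N - u))"
  proof (rule sum.cong[OF refl])
    fix u
    have "(\<Sum>P | P \<subseteq> noises circ \<and> card P = u. (4 * p) ^ card P * (1 + 8 * p) ^ (?N - card P))
        = (\<Sum>P | P \<subseteq> noises circ \<and> card P = u. (4 * p) ^ u * (1 + 8 * p) ^ (?N - u))"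
      by (rule sum.cong) auto
    then show "(\<Sum>P | P \<subseteq> noises circ \<and> card P = u. (4 * p) ^ card P * (1 + 8 * p) ^ (?N - card P))
        = real (?N choose u) * (4 * p) ^ u * (1 + 8 * p) ^ (?N - u)"
      using n_subsets[OF finite_noises] by simp
  qed
  \<comment> \<open>Strict in every summand: \<open>u\<close> and \<open>p\<close> are positive, so
    the first power grows strictly, and the binomial coefficient is positive. The range is nonempty
    because \<open>l < ?N\<close>.\<close>
  also have "\<dots> < (\<Sum>u=l+1..?N. real (?N choose u) * (16 * p) ^ u * (1 + 16 * p) ^ (?N - u))"
  proof (rule sum_strict_mono)
    fix u assume u: "u \<in> {l+1..?N}"
    have "(4 * p) ^ u * (1 + 8 * p) ^ (?N - u) < (16 * p) ^ u * (1 + 16 * p) ^ (?N - u)"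
      using p u by (intro mult_less_le_imp_less power_strict_mono power_mono) auto
    then show "real (?N choose u) * (4 * p) ^ u * (1 + 8 * p) ^ (?N - u)
        < real (?N choose u) * (16 * p) ^ u * (1 + 16 * p) ^ (?N - u)"
      using u by (simp add: mult.assoc zero_less_binomial)
  qed (use l in auto)
  finally show ?thesis .
qed

section \<open>The number of contractions\<close>

text \<open>With a ratio of at least 2, doubling the last term absorbs all earlier ones.\<close>

lemma geometric_sum_le:
  fixes x :: real
  assumes "2 \<le> x"
  shows "(\<Sum>u\<le>l. x ^ u) \<le> 2 * x ^ l"
proof (induction l)
  case (Suc l)
  have "2 * x ^ l \<le> x * x ^ l" using assms by (intro mult_right_mono) auto
  then show ?case using Suc by simp
qed simp

text \<open>The constant 4 is 2 contractions per run times the 2 of the geometric sum. The base 15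
  is \<open>4\<^sup>2 - 1\<close>, the number of residual terms of a two-qubit noise, which also
  bounds that of a single-qubit noise.\<close>

lemma num_contractions_le:
  assumes circ: "noisy_circuit n circ" and l: "l < card (noises circ)"
  shows "real (num_contractions circ w l \<psi> v) \<le> 4 * 15 ^ l * real (card (noises circ)) ^ l"
proof -
  let ?N = "card (noises circ)" and ?R = "\<lambda>P. \<Pi>\<^sub>E s\<in>P. {1..(ldim (circ ! s))\<^sup>2 - 1}"
  have R: "finite (?R P) \<and> card (?R P) \<le> 15 ^ card P" if P: "P \<subseteq> noises circ" for P
  proof
    have fP: "finite P" by (rule finite_subset[OF P finite_noises])
    show "finite (?R P)" using fP by (intro finite_PiE) auto
    have "card (?R P) = (\<Prod>s\<in>P. (ldim (circ ! s))\<^sup>2 - 1)" using fP by (simp add: card_PiE)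
    also have "\<dots> \<le> (\<Prod>s\<in>P. 15)"
    proof (rule prod_mono, rule conjI)
      fix s assume "s \<in> P"
      then have "valid_element n (circ ! s)" using circ P by (auto simp: noisy_circuit_def noises_def)
      then have "(ldim (circ ! s))\<^sup>2 \<le> 4\<^sup>2" by (intro power_mono ldim_le) auto
      then show "(ldim (circ ! s))\<^sup>2 - 1 \<le> 15" by simp
    qed simp
    finally show "card (?R P) \<le> 15 ^ card P" by simp
  qed
  have "num_contractions circ w l \<psi> v = 2 * card (runs circ l)"
  proof -
    have "length (networks circ w \<psi> v r) = 2" for r by (cases r) simp
    then show ?thesis by (simp add: num_contractions_def)
  qed
  also have "card (runs circ l) = (\<Sum>P | P \<subseteq> noises circ \<and> card P \<le> l. card (?R P))"
    unfolding runs_def using R by (intro card_SigmaI) auto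
  also have "\<dots> \<le> (\<Sum>P | P \<subseteq> noises circ \<and> card P \<le> l. 15 ^ card P)"
    using R by (intro sum_mono) auto
  also have "\<dots> = (\<Sum>P | P \<subseteq> noises circ \<and> card P \<in> {..l}. 15 ^ card P)" by simp
  also have "\<dots> = (\<Sum>u\<le>l. \<Sum>P | P \<subseteq> noises circ \<and> card P = u. 15 ^ card P)"
    by (rule sum_subsets_by_card[symmetric]) auto
  also have "\<dots> = (\<Sum>u\<le>l. (?N choose u) * 15 ^ u)"
    by (intro sum.cong refl) (simp add: n_subsets[symmetric])
  also have "\<dots> \<le> (\<Sum>u\<le>l. ?N ^ u * 15 ^ u)"
    using l by (intro sum_mono mult_right_mono binomial_le_pow) auto
  finally have "real (num_contractions circ w l \<psi> v) \<le> real (2 * (\<Sum>u\<le>l. ?N ^ u * 15 ^ u))"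
    by (simp only: of_nat_le_iff mult_le_mono2)
  also have "\<dots> = 2 * (\<Sum>u\<le>l. (15 * real ?N) ^ u)" by (simp add: power_mult_distrib mult.commute)
  \<comment> \<open>From \<open>l < ?N\<close> the number of noises is positive, so the base of the
    geometric sum is at least 15.\<close>
  also have "\<dots> \<le> 2 * (2 * (15 * real ?N) ^ l)" using l by (intro mult_left_mono geometric_sum_le) auto
  finally show ?thesis by (simp add: power_mult_distrib mult_ac)
qed

text \<open>The asymptotic claim is read in its strongest form: one constant \<open>C\<close>,
  chosen before the circuit, the level, the decompositions and the states. The equation for
  \<open>algorithm_output\<close> certifies that the contractions counted do compute the approximate
  value.\<close>

theorem theorem1:
  shows "\<exists>C>0. \<forall>(n::nat) circ (N1::nat) (N2::nat) (N::nat) (p::real) (l::nat) w \<psi> v.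
    noisy_circuit n circ \<longrightarrow>
    N1 = num_noises circ 1 \<longrightarrow> N2 = num_noises circ 2 \<longrightarrow> N = N1 + N2 \<longrightarrow>
    (\<forall>s\<in>noises circ. noise_rate (circ ! s) < p) \<longrightarrow>
    l < N \<longrightarrow>
    svd_choice circ w \<longrightarrow>
    \<psi> \<in> carrier_vec (2 ^ n) \<longrightarrow> l2_norm \<psi> = 1 \<longrightarrow>
    v \<in> carrier_vec (2 ^ n) \<longrightarrow> l2_norm v = 1 \<longrightarrow>
      cmod (exact_value n circ \<psi> v - approx_value n circ w l \<psi> v)
        < (\<Sum>u=l+1..N. real (N choose u) * (16 * p) ^ u * (1 + 16 * p) ^ (N - u))
    \<and> algorithm_output n circ w l \<psi> v = approx_value n circ w l \<psi> v
    \<and> real (num_contractions circ w l \<psi> v) \<le> C * 15 ^ l * real N ^ l"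
proof (intro exI[of _ 4] conjI allI impI)
  fix n circ N1 N2 N and p :: real and l w \<psi> v
  assume circ: "noisy_circuit n circ"
    and N: "N1 = num_noises circ 1" "N2 = num_noises circ 2" "N = N1 + N2"
    and rate: "\<forall>s\<in>noises circ. noise_rate (circ ! s) < p" and l: "l < N" and svd: "svd_choice circ w"
    and \<psi>: "\<psi> \<in> carrier_vec (2 ^ n)" "l2_norm \<psi> = 1" and v: "v \<in> carrier_vec (2 ^ n)" "l2_norm v = 1"
  have N': "N = card (noises circ)" using card_noises[OF circ] N by simp
  show "cmod (exact_value n circ \<psi> v - approx_value n circ w l \<psi> v)
      < (\<Sum>u=l+1..N. real (N choose u) * (16 * p) ^ u * (1 + 16 * p) ^ (N - u))"
    using rate l unfolding N' by (intro approx_error[OF circ svd _ _ \<psi> v]) auto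
  show "algorithm_output n circ w l \<psi> v = approx_value n circ w l \<psi> v"
    by (rule algorithm_output_eq_approx_value[OF circ \<psi>(1) v(1)])
  show "real (num_contractions circ w l \<psi> v) \<le> 4 * 15 ^ l * real N ^ l"
    using l unfolding N' by (rule num_contractions_le[OF circ])
qed simp

end
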